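(* Let $\mathcal{A}$ be a free line arrangement in the complex projective plane $\mathbb{P}^2$, consisting of $d=|\mathcal{A}|$ lines and such that $\mathcal{A}$ is not a pencil. Let $m$ be the maximal multiplicity of an intersection point in $\mathcal{A}$, and let $n_2$ be the number of double points of $\mathcal{A}$. If $2m\ge d$, then $$n_2\ \ge\ -2m^2+(3d-1)m-d^2+d\ \ge\ \frac{d}{2}.$$ In particular, if $\mathcal{A}$ is an $m$-homogeneous supersolvable line arrangement, not a pencil, consisting of $d=|\mathcal{A}|$ lines such that $2m\ge d$, then $n_2\ge \frac{d}{2}$.
   Context: A line arrangement in $\mathbb{P}^2$ is a finite set of distinct lines; it is a pencil if all its lines pass through one common point. An intersection point is a point lying on at least two lines of the arrangement; its multiplicity is the number of lines through it, and a double point is an intersection point of multiplicity exactly $2$. Let $S=\mathbb{C}[x,y,z]$ and $\mathrm{Der}\,S=S\partial_x\oplus S\partial_y\oplus S\partial_z$, and for each line $H\in\mathcal{A}$ let $\alpha_H$ be a linear form defining $H$. The arrangement $\mathcal{A}$ is free if the graded $S$-module $D(\mathcal{A})=\{\theta\in\mathrm{Der}\,S : \theta(\alpha_H)\in S\alpha_H \text{ for all } H\in\mathcal{A}\}$ is free. An intersection point $p$ is modular if for every other intersection point $q$ the line $\overline{pq}$ belongs to the arrangement. The arrangement is supersolvable if it has a modular point, and it is $m$-homogeneous supersolvable if it is supersolvable and all its modular points have the same multiplicity $m$. *)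

theory Defs
  imports
    "HOL-Analysis.Analysis"
    "HOL-Computational_Algebra.Polynomial"
begin

text \<open>
  The complex projective plane is the space of linear subspaces of \<open>\<complex>\<^sup>3\<close>: its points are the
  1-dimensional subspaces, its lines the 2-dimensional ones, and incidence is inclusion.
\<close>

definition proj_point :: "(complex^3) set \<Rightarrow> bool" where
  "proj_point p \<longleftrightarrow> vec.subspace p \<and> vec.dim p = 1"

definition proj_line :: "(complex^3) set \<Rightarrow> bool" where
  "proj_line H \<longleftrightarrow> vec.subspace H \<and> vec.dim H = 2"

definition line_arrangement :: "(complex^3) set set \<Rightarrow> bool" where
  "line_arrangement A \<longleftrightarrow> finite A \<and> (\<forall>H\<in>A. proj_line H)"

definition pencil :: "(complex^3) set set \<Rightarrow> bool" where
  "pencil A \<longleftrightarrow> (\<exists>p. proj_point p \<and> (\<forall>H\<in>A. p \<subseteq> H))"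

definition point_mult :: "(complex^3) set set \<Rightarrow> (complex^3) set \<Rightarrow> nat" where
  "point_mult A p = card {H \<in> A. p \<subseteq> H}"

definition intersection_points :: "(complex^3) set set \<Rightarrow> (complex^3) set set" where
  "intersection_points A = {p. proj_point p \<and> point_mult A p \<ge> 2}"

definition max_mult :: "(complex^3) set set \<Rightarrow> nat" where
  "max_mult A = Max (point_mult A ` intersection_points A)"

definition double_points :: "(complex^3) set set \<Rightarrow> (complex^3) set set" where
  "double_points A = {p \<in> intersection_points A. point_mult A p = 2}"

text \<open>For distinct points \<open>p\<close> and \<open>q\<close>, the line joining them is the subspace spanned by both.\<close>

definition modular_point :: "(complex^3) set set \<Rightarrow> (complex^3) set \<Rightarrow> bool" where
  "modular_point A p \<longleftrightarrow> p \<in> intersection_points A \<and>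
     (\<forall>q \<in> intersection_points A. q \<noteq> p \<longrightarrow> vec.span (p \<union> q) \<in> A)"

definition supersolvable :: "(complex^3) set set \<Rightarrow> bool" where
  "supersolvable A \<longleftrightarrow> (\<exists>p. modular_point A p)"

definition homogeneous_supersolvable :: "nat \<Rightarrow> (complex^3) set set \<Rightarrow> bool" where
  "homogeneous_supersolvable m A \<longleftrightarrow>
     supersolvable A \<and> (\<forall>p. modular_point A p \<longrightarrow> point_mult A p = m)"

text \<open>
  \<open>S = \<complex>[x,y,z]\<close> is the iterated polynomial ring \<open>\<complex>[x][y][z]\<close>, so \<open>z\<close> is the outermost variable.
\<close>

type_synonym S = "complex poly poly poly"

definition const :: "complex \<Rightarrow> S" where "const c = [:[:[:c:]:]:]"
definition varx :: S where "varx = [:[:[:0, 1:]:]:]"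
definition vary :: S where "vary = [:[:0, 1:]:]"
definition varz :: S where "varz = [:0, 1:]"

definition dx :: "S \<Rightarrow> S" where "dx f = map_poly (map_poly pderiv) f"
definition dy :: "S \<Rightarrow> S" where "dy f = map_poly pderiv f"
definition dz :: "S \<Rightarrow> S" where "dz f = pderiv f"

text \<open>
  An element \<open>\<theta>\<close> of \<open>S^3\<close> stands for the derivation
  \<open>\<theta>$1 \<partial>\<^sub>x + \<theta>$2 \<partial>\<^sub>y + \<theta>$3 \<partial>\<^sub>z\<close> in \<open>Der S = S \<partial>\<^sub>x \<oplus> S \<partial>\<^sub>y \<oplus> S \<partial>\<^sub>z\<close>.
\<close>

definition der_apply :: "S^3 \<Rightarrow> S \<Rightarrow> S" where
  "der_apply \<theta> f = \<theta>$1 * dx f + \<theta>$2 * dy f + \<theta>$3 * dz f"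

definition linear_form :: "complex^3 \<Rightarrow> S" where
  "linear_form a = const (a$1) * varx + const (a$2) * vary + const (a$3) * varz"

definition defining_form :: "(complex^3) set \<Rightarrow> S \<Rightarrow> bool" where
  "defining_form H \<alpha> \<longleftrightarrow>
     (\<exists>a. \<alpha> = linear_form a \<and> H = {v. a$1 * v$1 + a$2 * v$2 + a$3 * v$3 = 0})"

text \<open>
  The linear form defining a line is unique up to a nonzero scalar, which does not affect the
  condition; hence the quantification over all of them amounts to any choice of one per line.
\<close>

definition derivation_module :: "(complex^3) set set \<Rightarrow> (S^3) set" where
  "derivation_module A =
     {\<theta>. \<forall>H\<in>A. \<forall>\<alpha>. defining_form H \<alpha> \<longrightarrow> \<alpha> dvd der_apply \<theta> \<alpha>}"

interpretation DerS: module "(*s) :: S \<Rightarrow> S^3 \<Rightarrow> S^3"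
  by unfold_locales (simp_all add: vec_eq_iff algebra_simps)

lemma subspace_derivation_module: "DerS.subspace (derivation_module A)"
  unfolding DerS.subspace_def derivation_module_def der_apply_def
proof (safe, goal_cases)
  case (2 \<theta> \<eta> H \<alpha>)
  have "\<alpha> dvd (\<theta>$1 * dx \<alpha> + \<theta>$2 * dy \<alpha> + \<theta>$3 * dz \<alpha>) + (\<eta>$1 * dx \<alpha> + \<eta>$2 * dy \<alpha> + \<eta>$3 * dz \<alpha>)"
    by (rule dvd_add) (use 2 in blast)+
  then show ?case by (simp add: algebra_simps)
next
  case (3 c \<theta> H \<alpha>)
  have "\<alpha> dvd c * (\<theta>$1 * dx \<alpha> + \<theta>$2 * dy \<alpha> + \<theta>$3 * dz \<alpha>)"
    by (rule dvd_mult) (use 3 in blast)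
  then show ?case by (simp add: algebra_simps)
qed simp

definition free_arrangement :: "(complex^3) set set \<Rightarrow> bool" where
  "free_arrangement A \<longleftrightarrow>
     (\<exists>B. DerS.independent B \<and> DerS.span B = derivation_module A)"

end

theory Submission
  imports Defs
begin

text \<open>
  Let \<open>p\<close> be a point of multiplicity \<open>m\<close> with \<open>2m \<ge> d\<close>. If \<open>p\<close> is modular, every line \<open>L\<close> off \<open>p\<close>
  carries exactly \<open>m\<close> intersection points; as these absorb the \<open>d - 1\<close> other lines, at least
  \<open>2m - d + 1\<close> of them are double, and no double point is shared by two such lines. This gives
  \<open>n\<^sub>2 \<ge> (d - m)(2m - d + 1)\<close>, which is the claimed bound.

  So it suffices that freeness makes \<open>p\<close> modular. By Saito's criterion \<open>D(A)\<close> has a homogeneous basis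
  \<open>E, \<theta>\<^sub>1, \<theta>\<^sub>2\<close> with \<open>E\<close> the Euler field, \<open>det(E, \<theta>\<^sub>1, \<theta>\<^sub>2) = c Q\<close> and degrees \<open>d\<^sub>1 \<le> d\<^sub>2\<close>,
  \<open>d\<^sub>1 + d\<^sub>2 = d - 1\<close>. If \<open>p\<close> is not modular, some line \<open>L\<close> off \<open>p\<close> carries at least \<open>m + 1\<close>
  intersection points, and then every \<open>\<theta> \<in> D(A)\<close> of degree below \<open>m\<close> is a multiple of \<open>E\<close> along \<open>L\<close>:
  \<open>\<theta> \<and> E\<close> has degree at most \<open>m\<close> and vanishes at these points. This applies to \<open>\<theta>\<^sub>1\<close>. Two such fields
  cannot complete \<open>E\<close> to a basis, for then \<open>Q\<close> would be divisible by the square of the form of \<open>L\<close>;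
  hence \<open>d\<^sub>2 \<ge> m\<close>. The field \<open>\<theta>\<^sub>p = Q' w\<close>, where \<open>w\<close> spans \<open>p\<close> and \<open>Q'\<close> is the product of the forms
  of the lines off \<open>p\<close>, vanishes on \<open>L\<close>, so by the same argument \<open>\<theta>\<^sub>p = g E + f \<theta>\<^sub>1\<close>. But then \<open>f\<close> must be
  constant, while its degree is \<open>d\<^sub>2 + 1 - m \<ge> 1\<close>.
\<close>

section \<open>Evaluation of polynomials\<close>

text \<open>The first substitution is for \<open>z\<close>, the outermost variable of the nested
  type. Values determine elements of \<open>S\<close>, so later identities are checked
  pointwise.\<close>

definition ev :: "S \<Rightarrow> complex^3 \<Rightarrow> complex" where
  "ev f v = poly (poly (poly f [:[:v$3:]:]) [:v$2:]) (v$1)"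

lemma ev_simps [simp]:
  "ev 0 v = 0" "ev 1 v = 1" "ev (f + g) v = ev f v + ev g v" "ev (f - g) v = ev f v - ev g v"
  "ev (- f) v = - ev f v" "ev (f * g) v = ev f v * ev g v" "ev (f ^ n) v = ev f v ^ n"
  "ev (const c) v = c" "ev varx v = v$1" "ev vary v = v$2" "ev varz v = v$3"
  by (simp_all add: ev_def const_def varx_def vary_def varz_def)

lemma ev_sum [simp]: "ev (sum f I) v = (\<Sum>i\<in>I. ev (f i) v)"
  by (induction I rule: infinite_finite_induct) auto

lemma ev_prod [simp]: "ev (prod f I) v = (\<Prod>i\<in>I. ev (f i) v)"
  by (induction I rule: infinite_finite_induct) auto

lemma poly_eq_0_if_const_roots:
  fixes f :: "'a::idom poly poly"
  assumes "infinite (UNIV :: 'a set)" "\<And>c. poly f [:c:] = 0"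
  shows "f = 0"
proof (rule ccontr)
  assume "f \<noteq> 0"
  then have "finite {x. poly f x = 0}" by (rule poly_roots_finite)
  then have "finite (range (\<lambda>c. [:c:] :: 'a poly))"
    by (rule rev_finite_subset) (use assms(2) in auto)
  then show False
    using assms(1) by (simp add: finite_image_iff inj_on_def)
qed

lemma poly2_eq_0:
  fixes g :: "complex poly poly"
  assumes "\<And>x y. poly (poly g [:y:]) x = 0"
  shows "g = 0"
proof (rule poly_eq_0_if_const_roots)
  show "infinite (UNIV :: complex set)" by (rule infinite_UNIV_char_0)
  show "poly g [:y:] = 0" for y
    using assms by (simp add: poly_all_0_iff_0 [symmetric])
qed

lemma ev_eq_0D:
  assumes "\<And>v. ev f v = 0"
  shows "f = 0"
proof (rule ccontr)
  assume "f \<noteq> 0"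
  then have "finite {x. poly f x = 0}" by (rule poly_roots_finite)
  moreover have "poly f [:[:z:]:] = 0" for z
  proof (rule poly2_eq_0)
    fix x y
    show "poly (poly (poly f [:[:z:]:]) [:y:]) x = 0"
      using assms[of "vector [x, y, z]"] by (simp add: ev_def)
  qed
  then have "range (\<lambda>z::complex. [:[:z:]:]) \<subseteq> {x. poly f x = 0}" by auto
  ultimately have "finite (range (\<lambda>z::complex. [:[:z:]:]))"
    by (rule finite_subset [rotated])
  then show False
    by (simp add: finite_image_iff inj_on_def infinite_UNIV_char_0)
qed

lemma S_eqI:
  assumes "\<And>v. ev f v = ev g v"
  shows "f = g"
  using ev_eq_0D[of "f - g"] assms by simp

text \<open>Sums and multiplication by variables generate everything from the constants; induction
  in this form hides the three nested layers, unwound here one after the other.\<close>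

lemma S_induct [case_names const add x y z]:
  assumes const: "\<And>c. P (const c)"
    and add: "\<And>f g. P f \<Longrightarrow> P g \<Longrightarrow> P (f + g)"
    and x: "\<And>f. P f \<Longrightarrow> P (varx * f)"
    and y: "\<And>f. P f \<Longrightarrow> P (vary * f)"
    and z: "\<And>f. P f \<Longrightarrow> P (varz * f)"
  shows "P f"
proof -
  have 1: "P [:[:h:]:]" for h
  proof (induction h)
    case 0
    then show ?case using const[of 0] by (simp add: const_def)
  next
    case (pCons a h)
    have "[:[:pCons a h:]:] = const a + varx * [:[:h:]:]"
      by (simp add: const_def varx_def)
    then show ?case using pCons const x add by metis
  qed
  have 2: "P [:g:]" for g
  proof (induction g)
    case 0
    then show ?case using const[of 0] by (simp add: const_def)
  next
    case (pCons a h)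
    have "[:pCons a h:] = [:[:a:]:] + vary * [:h:]"
      by (simp add: vary_def)
    then show ?case using pCons 1 y add by metis
  qed
  show ?thesis
  proof (induction f)
    case 0
    then show ?case using const[of 0] by (simp add: const_def)
  next
    case (pCons a h)
    have "pCons a h = [:a:] + varz * h"
      by (simp add: varz_def)
    then show ?case using pCons 2 z add by metis
  qed
qed

lemma ev_affine_line:
  "\<exists>p. \<forall>t. ev f (v + t *s w) = poly p t"
proof (induction f rule: S_induct)
  case (const c)
  then show ?case by (intro exI[of _ "[:c:]"]) simp
next
  case (add f g)
  then obtain p q where "\<forall>t. ev f (v + t *s w) = poly p t" "\<forall>t. ev g (v + t *s w) = poly q t"
    by auto
  then show ?case by (intro exI[of _ "p + q"]) simp
next
  case (x f)
  then obtain p where "\<forall>t. ev f (v + t *s w) = poly p t"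
    by auto
  then show ?case by (intro exI[of _ "[:v$1, w$1:] * p"]) (simp add: algebra_simps)
next
  case (y f)
  then obtain p where "\<forall>t. ev f (v + t *s w) = poly p t"
    by auto
  then show ?case by (intro exI[of _ "[:v$2, w$2:] * p"]) (simp add: algebra_simps)
next
  case (z f)
  then obtain p where "\<forall>t. ev f (v + t *s w) = poly p t"
    by auto
  then show ?case by (intro exI[of _ "[:v$3, w$3:] * p"]) (simp add: algebra_simps)
qed

section \<open>Linear forms and divisibility by them\<close>

definition dot3 :: "'a::comm_ring_1^3 \<Rightarrow> 'a^3 \<Rightarrow> 'a" where
  "dot3 a v = a$1 * v$1 + a$2 * v$2 + a$3 * v$3"

definition ker3 :: "complex^3 \<Rightarrow> (complex^3) set" where
  "ker3 a = {v. dot3 a v = 0}"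

lemma mem_ker3: "v \<in> ker3 a \<longleftrightarrow> dot3 a v = 0"
  by (simp add: ker3_def)

lemma ev_linear_form [simp]: "ev (linear_form a) v = dot3 a v"
  by (simp add: linear_form_def dot3_def)

lemma dot3_add [simp]: "dot3 a (v + w) = dot3 a v + dot3 a w"
  and dot3_smult [simp]: "dot3 a (c *s v) = c * dot3 a v"
  by (simp_all add: dot3_def algebra_simps)

text \<open>A linear subspace is irreducible: on the line joining a point with \<open>f\<close>
  nonzero to one with \<open>g\<close> nonzero, both restrictions are nonzero polynomials in
  \<open>t\<close>, yet their product vanishes identically.\<close>

lemma vanish_prime:
  assumes "vec.subspace H" and fg: "\<And>v. v \<in> H \<Longrightarrow> ev (f * g) v = 0"
  shows "(\<forall>v\<in>H. ev f v = 0) \<or> (\<forall>v\<in>H. ev g v = 0)"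
proof (rule ccontr)
  assume "\<not> ?thesis"
  then obtain v w where vw: "v \<in> H" "w \<in> H" "ev f v \<noteq> 0" "ev g w \<noteq> 0" by auto
  obtain p where p: "\<And>t. ev f (v + t *s (w - v)) = poly p t"
    using ev_affine_line[of f v "w - v"] by blast
  obtain q where q: "\<And>t. ev g (v + t *s (w - v)) = poly q t"
    using ev_affine_line[of g v "w - v"] by blast
  have "poly (p * q) t = 0" for t
  proof -
    have "v + t *s (w - v) \<in> H"
      using assms(1) vw by (intro vec.subspace_add vec.subspace_scale vec.subspace_diff)
    then show ?thesis using fg[of "v + t *s (w - v)"] by (simp only: ev_simps p q poly_mult)
  qed
  then have "p * q = 0" using poly_all_0_iff_0 by blast
  then have "p = 0 \<or> q = 0" by simp
  then show False using p[of 0] q[of 1] vw by auto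
qed

text \<open>Factor theorem: up to a scalar, the form is a variable minus its solution in terms of
  the others. The cases follow the layer of the nested type in which that variable lives.\<close>

lemma linear_form_dvd_iff:
  assumes "a \<noteq> 0"
  shows "linear_form a dvd f \<longleftrightarrow> (\<forall>v\<in>ker3 a. ev f v = 0)"
proof
  assume "linear_form a dvd f"
  then show "\<forall>v\<in>ker3 a. ev f v = 0" by (auto simp: mem_ker3 elim!: dvdE)
next
  assume van: "\<forall>v\<in>ker3 a. ev f v = 0"
  have lf: "linear_form a = [:[:[:0, a$1:], [:a$2:]:], [:[:a$3:]:]:]"
    by (simp add: linear_form_def const_def varx_def vary_def varz_def)
  consider "a$3 \<noteq> 0" | "a$3 = 0" "a$2 \<noteq> 0" | "a$3 = 0" "a$2 = 0" "a$1 \<noteq> 0"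
    using assms by (auto simp: vec_eq_iff forall_3)
  then show "linear_form a dvd f"
  proof cases
    case 1
    define z0 :: "complex poly poly" where "z0 = [:[:0, - a$1 / a$3:], [:- a$2 / a$3:]:]"
    have "poly f z0 = 0"
    proof (rule poly2_eq_0)
      fix x y
      define z where "z = - a$1 / a$3 * x + - a$2 / a$3 * y"
      have "poly (poly z0 [:y:]) x = z"
        by (simp add: z0_def z_def algebra_simps)
      have "poly (poly (poly f z0) [:y:]) x = poly (poly (poly f [:[:z:]:]) [:y:]) x"
        by (induction f) (simp_all add: \<open>poly (poly z0 [:y:]) x = z\<close>)
      also have "\<dots> = ev f (vector [x, y, z])" by (simp add: ev_def)
      also have "\<dots> = 0"
        using van 1 by (intro van[rule_format]) (simp add: mem_ker3 dot3_def z_def field_simps)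
      finally show "poly (poly (poly f z0) [:y:]) x = 0" .
    qed
    then have "[:- z0, 1:] dvd f" by (simp add: poly_eq_0_iff_dvd)
    moreover have "linear_form a * const (1 / a$3) = [:- z0, 1:]"
      using 1 by (simp add: lf const_def z0_def one_pCons)
    ultimately show ?thesis by (metis dvd_mult_left)
  next
    case 2
    define y0 :: "complex poly" where "y0 = [:0, - a$1 / a$2:]"
    \<comment> \<open>\<open>y\<close> is the middle layer, so divisibility is tested on each
      coefficient with respect to \<open>z\<close>.\<close>
    have "[:- y0, 1:] dvd coeff f k" for k
    proof -
      have "map_poly (\<lambda>g. poly g y0) f = 0"
      proof (rule poly2_eq_0)
        fix x z
        define y where "y = - a$1 / a$2 * x"
        have "poly y0 x = y"
          by (simp add: y0_def y_def algebra_simps)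
        have g: "poly (poly g y0) x = poly (poly g [:y:]) x" for g
          by (induction g) (simp_all add: \<open>poly y0 x = y\<close>)
        have "poly (poly (map_poly (\<lambda>g. poly g y0) f) [:z:]) x = poly (poly (poly f [:[:z:]:]) [:y:]) x"
          by (induction f) (simp_all add: map_poly_pCons g)
        also have "\<dots> = ev f (vector [x, y, z])" by (simp add: ev_def)
        also have "\<dots> = 0"
          using van 2 by (intro van[rule_format]) (simp add: mem_ker3 dot3_def y_def field_simps)
        finally show "poly (poly (map_poly (\<lambda>g. poly g y0) f) [:z:]) x = 0" .
      qed
      then have "poly (coeff f k) y0 = 0"
        by (metis coeff_0 coeff_map_poly poly_0)
      then show ?thesis by (simp add: poly_eq_0_iff_dvd)
    qed
    then have "[:[:- y0, 1:]:] dvd f" by (simp add: const_poly_dvd_iff)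
    moreover have "linear_form a * const (1 / a$2) = [:[:- y0, 1:]:]"
      using 2 by (simp add: lf const_def y0_def one_pCons)
    ultimately show ?thesis by (metis dvd_mult_left)
  next
    case 3
    have "[:0, 1:] dvd coeff (coeff f k) j" for k j
    proof -
      have "map_poly (map_poly (\<lambda>h. poly h 0)) f = 0"
      proof (rule poly2_eq_0)
        fix y z :: complex
        have g: "poly (map_poly (\<lambda>h. poly h 0) g) y = poly (poly g [:y:]) 0" for g :: "complex poly poly"
          by (induction g) (simp_all add: map_poly_pCons)
        have "poly (poly (map_poly (map_poly (\<lambda>h. poly h 0)) f) [:z:]) y
            = poly (poly (poly f [:[:z:]:]) [:y:]) 0"
          by (induction f) (simp_all add: map_poly_pCons g)
        also have "\<dots> = ev f (vector [0, y, z])" by (simp add: ev_def)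
        also have "\<dots> = 0"
          using van 3 by (intro van[rule_format]) (simp add: mem_ker3 dot3_def)
        finally show "poly (poly (map_poly (map_poly (\<lambda>h. poly h 0)) f) [:z:]) y = 0" .
      qed
      then have "map_poly (\<lambda>h. poly h 0) (coeff f k) = 0"
        by (metis coeff_0 coeff_map_poly map_poly_0)
      then have "poly (coeff (coeff f k) j) 0 = 0"
        by (metis coeff_0 coeff_map_poly poly_0)
      then show ?thesis using poly_eq_0_iff_dvd[of _ "0::complex"] by simp
    qed
    then have "[:[:[:0, 1:]:]:] dvd f" by (simp add: const_poly_dvd_iff)
    moreover have "linear_form a * const (1 / a$1) = [:[:[:0, 1:]:]:]"
      using 3 by (simp add: lf const_def one_pCons)
    ultimately show ?thesis by (metis dvd_mult_left)
  qed
qed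

section \<open>Homogeneous polynomials\<close>

text \<open>Stated through values rather than monomials; the zero polynomial has every
  degree.\<close>

definition homogeneous :: "nat \<Rightarrow> S \<Rightarrow> bool" where
  "homogeneous n f \<longleftrightarrow> (\<forall>t v. ev f (t *s v) = t ^ n * ev f v)"

lemma homogeneous_ev: "homogeneous n f \<Longrightarrow> ev f (t *s v) = t ^ n * ev f v"
  by (simp add: homogeneous_def)

lemma homogeneous_0 [simp]: "homogeneous n 0"
  and homogeneous_const [simp]: "homogeneous 0 (const c)"
  and homogeneous_add: "homogeneous n f \<Longrightarrow> homogeneous n g \<Longrightarrow> homogeneous n (f + g)"
  and homogeneous_diff: "homogeneous n f \<Longrightarrow> homogeneous n g \<Longrightarrow> homogeneous n (f - g)"
  and homogeneous_mult: "homogeneous n f \<Longrightarrow> homogeneous k g \<Longrightarrow> homogeneous (n + k) (f * g)"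
  and homogeneous_linear_form: "homogeneous 1 (linear_form a)"
  and homogeneous_varx: "homogeneous 1 varx" and homogeneous_vary: "homogeneous 1 vary" and homogeneous_varz: "homogeneous 1 varz"
  by (simp_all add: homogeneous_def algebra_simps power_add)

lemma homogeneous_prod: "finite I \<Longrightarrow> (\<And>i. i \<in> I \<Longrightarrow> homogeneous 1 (f i)) \<Longrightarrow> homogeneous (card I) (prod f I)"
proof (induction I rule: finite_induct)
  case empty
  then show ?case by (simp add: homogeneous_def)
next
  case (insert i I)
  then show ?case using homogeneous_mult[of 1 "f i" "card I" "prod f I"] by simp
qed

lemma poly_sum_monom: "poly (\<Sum>k\<le>N. monom (a k) k) t = (\<Sum>k\<le>N. a k * t ^ k)"
  for t :: "'a::comm_ring_1"
  by (simp add: poly_sum poly_monom)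

text \<open>Evaluation at \<open>t *s v\<close> turns a sum of homogeneous components into a power
  sum in \<open>t\<close>; comparing coefficients isolates each component.\<close>

lemma power_sum_coeffs_eq:
  fixes a b :: "nat \<Rightarrow> complex"
  assumes "\<And>t. (\<Sum>k\<le>N. a k * t ^ k) = (\<Sum>k\<le>N. b k * t ^ k)" "k \<le> N"
  shows "a k = b k"
proof -
  have "poly (\<Sum>k\<le>N. monom (a k) k) = poly (\<Sum>k\<le>N. monom (b k) k)"
    using assms by (simp add: poly_sum_monom fun_eq_iff)
  then have "(\<Sum>k\<le>N. monom (a k) k) = (\<Sum>k\<le>N. monom (b k) k)"
    by (simp add: poly_eq_poly_eq_iff)
  then have "coeff (\<Sum>k\<le>N. monom (a k) k) k = coeff (\<Sum>k\<le>N. monom (b k) k) k" by simp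
  then show ?thesis using assms(2) by (simp add: coeff_sum)
qed

text \<open>Multiplication by a variable shifts all components up by one degree. The vanishing
  beyond \<open>N\<close> lets two decompositions be padded to a common length.\<close>

lemma homogeneous_decomp:
  "\<exists>c N. (\<forall>k. homogeneous k (c k)) \<and> (\<forall>k>N. c k = 0) \<and> f = (\<Sum>k\<le>N. c k)"
proof (induction f rule: S_induct)
  case (const a)
  show ?case
    by (intro exI[of _ "\<lambda>k. if k = 0 then const a else 0"] exI[of _ "0::nat"]) auto
next
  case (add f g)
  then obtain c N d M where
    c: "\<And>k. homogeneous k (c k)" "\<And>k. k > N \<Longrightarrow> c k = 0" "f = (\<Sum>k\<le>N. c k)" and
    d: "\<And>k. homogeneous k (d k)" "\<And>k. k > M \<Longrightarrow> d k = 0" "g = (\<Sum>k\<le>M. d k)" by metis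
  have "f = (\<Sum>k\<le>max N M. c k)"
    unfolding c(3) by (rule sum.mono_neutral_left) (auto simp: c(2))
  moreover have "g = (\<Sum>k\<le>max N M. d k)"
    unfolding d(3) by (rule sum.mono_neutral_left) (auto simp: d(2))
  ultimately have "f + g = (\<Sum>k\<le>max N M. c k + d k)" by (simp add: sum.distrib)
  then show ?case
    using c d by (intro exI[of _ "\<lambda>k. c k + d k"] exI[of _ "max N M"]) (auto intro: homogeneous_add)
next
  have shift: "\<exists>c N. (\<forall>k. homogeneous k (c k)) \<and> (\<forall>k>N. c k = 0) \<and> X * f = (\<Sum>k\<le>N. c k)"
    if X: "homogeneous 1 X" and f: "\<exists>c N. (\<forall>k. homogeneous k (c k)) \<and> (\<forall>k>N. c k = 0) \<and> f = (\<Sum>k\<le>N. c k)" for X f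
  proof -
    obtain c N where c: "\<And>k. homogeneous k (c k)" "\<And>k. k > N \<Longrightarrow> c k = 0" "f = (\<Sum>k\<le>N. c k)"
      using f by metis
    let ?d = "\<lambda>k. case k of 0 \<Rightarrow> 0 | Suc j \<Rightarrow> X * c j"
    have "homogeneous k (?d k)" for k
      using homogeneous_mult[OF X c(1)] by (cases k) auto
    moreover have "X * f = (\<Sum>k\<le>Suc N. ?d k)"
      by (simp only: c(3) sum.atMost_Suc_shift) (simp add: sum_distrib_left)
    moreover have "?d k = 0" if "k > Suc N" for k
      using that c(2) by (cases k) auto
    ultimately show ?thesis by blast
  qed
  {
    case (x f) then show ?case by (rule shift[OF homogeneous_varx])
  next
    case (y f) then show ?case by (rule shift[OF homogeneous_vary])
  next
    case (z f) then show ?case by (rule shift[OF homogeneous_varz])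
  }
qed

lemma ev_scale_homogeneous_sum:
  assumes "\<And>k. homogeneous k (c k)" "f = (\<Sum>k\<le>N. c k)"
  shows "ev f (t *s v) = (\<Sum>k\<le>N. ev (c k) v * t ^ k)"
  unfolding assms(2) by (simp add: homogeneous_ev[OF assms(1)] mult.commute)

lemma homogeneous_sum_unique:
  assumes c: "\<And>k. homogeneous k (c k)" and "homogeneous n (\<Sum>k\<le>N. c k)" "k \<le> N" "k \<noteq> n"
  shows "c k = 0"
proof (rule ev_eq_0D)
  fix v
  let ?f = "\<Sum>k\<le>N. c k"
  \<comment> \<open>Padded by zeros up to \<open>max N n\<close>, as \<open>n\<close> may exceed
    \<open>N\<close>.\<close>
  define a where "a k = (if k \<le> N then ev (c k) v else 0)" for k
  have "(\<Sum>k\<le>max N n. a k * t ^ k) = (\<Sum>k\<le>max N n. (if k = n then ev ?f v else 0) * t ^ k)" for t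
  proof -
    have "(\<Sum>k\<le>max N n. a k * t ^ k) = (\<Sum>k\<le>N. ev (c k) v * t ^ k)"
      by (rule sum.mono_neutral_cong_right) (auto simp: a_def)
    also have "\<dots> = ev ?f (t *s v)" by (rule ev_scale_homogeneous_sum[OF c refl, symmetric])
    also have "\<dots> = t ^ n * ev ?f v" by (rule homogeneous_ev[OF assms(2)])
    also have "\<dots> = (\<Sum>k\<le>max N n. (if k = n then ev ?f v else 0) * t ^ k)"
      by (subst sum.remove[of _ n]) auto
    finally show ?thesis .
  qed
  then have "a k = (if k = n then ev ?f v else 0)"
    by (rule power_sum_coeffs_eq) (use assms in auto)
  then show "ev (c k) v = 0" using assms by (simp add: a_def)
qed

text \<open>The products of \<open>f\<close> with the components \<open>c j\<close> of
  \<open>g\<close> have degrees \<open>k + j\<close>, so all but the one of degree \<open>n\<close>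
  vanish, and \<open>g\<close> is left with a single component.\<close>

lemma homogeneous_quotient:
  assumes "f \<noteq> 0" "homogeneous k f" "homogeneous n (f * g)" "g \<noteq> 0"
  shows "k \<le> n \<and> homogeneous (n - k) g"
proof -
  obtain c N where c: "\<And>k. homogeneous k (c k)" "\<And>k. k > N \<Longrightarrow> c k = 0" "g = (\<Sum>k\<le>N. c k)"
    using homogeneous_decomp[of g] by metis
  have c0: "c j = 0" if "k + j \<noteq> n" for j
  proof (cases "j \<le> N")
    case True
    define d where "d i = (if i < k then 0 else f * c (i - k))" for i
    have "homogeneous i (d i)" for i
      using homogeneous_mult[OF assms(2) c(1), of "i - k"] by (auto simp: d_def)
    moreover have "(\<Sum>i\<le>N + k. d i) = f * g"
    proof -
      have "(\<Sum>i\<le>N + k. d i) = (\<Sum>i\<in>{k..N + k}. f * c (i - k))"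
        by (rule sum.mono_neutral_cong_right) (auto simp: d_def)
      also have "\<dots> = (\<Sum>j\<le>N. f * c j)"
        by (rule sum.reindex_bij_witness[of _ "\<lambda>j. j + k" "\<lambda>i. i - k"]) auto
      finally show ?thesis by (simp add: c(3) sum_distrib_left)
    qed
    ultimately have "d (k + j) = 0"
      using assms(3) True that by (intro homogeneous_sum_unique[where n = n and N = "N + k"]) auto
    then show ?thesis using assms(1) by (simp add: d_def)
  qed (use c in auto)
  have "k \<le> n"
  proof (rule ccontr)
    assume "\<not> k \<le> n"
    then have "c j = 0" for j by (intro c0) auto
    then show False using assms(4) c(3) by simp
  qed
  have "g = c (n - k)"
  proof (cases "n - k \<le> N")
    case True
    then have "g = c (n - k) + sum c ({..N} - {n - k})"
      unfolding c(3) by (intro sum.remove) auto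
    also have "sum c ({..N} - {n - k}) = 0"
      by (rule sum.neutral) (use c0 \<open>k \<le> n\<close> in force)
    finally show ?thesis by simp
  next
    case False
    then have "g = 0" unfolding c(3) by (intro sum.neutral ballI c0) auto
    then show ?thesis using assms(4) by simp
  qed
  then show ?thesis using c(1) \<open>k \<le> n\<close> by simp
qed

lemma homogeneous_0_const:
  assumes "homogeneous 0 f"
  shows "f = const (ev f 0)"
proof (rule S_eqI)
  fix v
  show "ev f v = ev (const (ev f 0)) v" using homogeneous_ev[OF assms, of 0 v] by simp
qed

lemma homogeneous_const_pos: "homogeneous n (const c) \<Longrightarrow> n > 0 \<Longrightarrow> c = 0"
  using homogeneous_ev[of n "const c" 0 0] by (auto simp: power_0_left)

section \<open>Binary forms and their zeros\<close>

lemma poly_eq_power_times_poly_inverse_degree: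
  fixes p r :: "complex poly"
  assumes "\<And>t. t \<noteq> 0 \<Longrightarrow> poly p t = t ^ n * poly r (inverse t)"
  shows "degree p \<le> n"
proof (cases "p = 0")
  case False
  \<comment> \<open>Multiplication by \<open>t ^ k\<close> turns values of \<open>r\<close> at
    \<open>inverse t\<close> into values of \<open>reflect_poly r\<close>, whose degree is at most
    \<open>k\<close>.\<close>
  define k where "k = degree r"
  have "poly (monom 1 k * p) t = poly (monom 1 n * reflect_poly r) t" if "t \<noteq> 0" for t
    using that by (simp add: assms poly_monom poly_reflect_poly_nz k_def)
  \<comment> \<open>The extra factor \<open>t\<close> makes the identity hold at
    \<open>t = 0\<close> too; it is cancelled afterwards.\<close>
  then have "poly (monom 1 1 * (monom 1 k * p)) t = poly (monom 1 1 * (monom 1 n * reflect_poly r)) t" for t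
    by (cases "t = 0") (simp_all add: poly_monom)
  then have "monom 1 1 * (monom 1 k * p) = monom 1 1 * (monom 1 n * reflect_poly r)"
    by (intro iffD1[OF poly_eq_poly_eq_iff] ext)
  then have eq: "monom 1 k * p = monom 1 n * reflect_poly r"
    by (simp add: monom_eq_0_iff)
  then have "reflect_poly r \<noteq> 0" using False by (auto simp: monom_eq_0_iff)
  then have "k + degree p = n + degree (reflect_poly r)"
    using arg_cong[OF eq, of degree] False by (simp add: degree_mult_eq degree_monom_eq monom_eq_0_iff)
  then show ?thesis using degree_reflect_poly_le[of r] by (simp add: k_def)
qed simp

text \<open>\<open>f\<close> restricts to a binary form of degree \<open>n\<close> on the line spanned by \<open>u\<close> and \<open>w\<close>; its \<open>n + 1\<close>
  projective zeros are \<open>u\<close> and the points \<open>w + a u\<close> for \<open>a \<in> R\<close>.\<close>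

lemma binary_form_eq_0:
  assumes f: "homogeneous n f" and u: "ev f u = 0"
    and R: "finite R" "card R \<ge> n" "\<And>a. a \<in> R \<Longrightarrow> ev f (w + a *s u) = 0"
  shows "ev f (a *s u + b *s w) = 0"
proof (cases n)
  case 0
  then show ?thesis using f u homogeneous_0_const[of f] by (metis ev_simps(8))
next
  case (Suc k)
  obtain p where p: "\<And>t. ev f (w + t *s u) = poly p t"
    using ev_affine_line[of f w u] by blast
  obtain r where r: "\<And>t. ev f (u + t *s w) = poly r t"
    using ev_affine_line[of f u w] by blast
  \<comment> \<open>\<open>u\<close> is the point at infinity of the chart
    \<open>w + t *s u\<close>; the zero there lowers the degree bound for \<open>p\<close> from
    \<open>n\<close> to \<open>k\<close>, below the number of roots in \<open>R\<close>.\<close>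
  have "poly r 0 = 0" using r[of 0] u by simp
  then obtain r' where r': "r = [:0, 1:] * r'"
    using poly_eq_0_iff_dvd[of r 0] by (auto elim!: dvdE)
  have "poly p t = t ^ k * poly r' (inverse t)" if "t \<noteq> 0" for t
  proof -
    have "w + t *s u = t *s (u + inverse t *s w)"
      using that by (simp add: vec_eq_iff algebra_simps)
    then have "poly p t = t ^ n * poly r (inverse t)"
      by (metis p r homogeneous_ev[OF f])
    then show ?thesis using that Suc by (simp add: r')
  qed
  then have deg: "degree p \<le> k" by (rule poly_eq_power_times_poly_inverse_degree)
  have p0: "p = 0"
  proof (rule ccontr)
    assume "p \<noteq> 0"
    then have fin: "finite {t. poly p t = 0}" by (rule poly_roots_finite)
    have "R \<subseteq> {t. poly p t = 0}" using R(3) p by auto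
    then have "card R \<le> card {t. poly p t = 0}" using fin by (rule card_mono[rotated])
    also have "\<dots> \<le> degree p" using \<open>p \<noteq> 0\<close> by (rule card_poly_roots_bound)
    finally show False using deg R(2) Suc by simp
  qed
  show ?thesis
  proof (cases "b = 0")
    case True
    then show ?thesis using homogeneous_ev[OF f, of a u] u by simp
  next
    case False
    then have "a *s u + b *s w = b *s (w + (a / b) *s u)"
      by (simp add: vec_eq_iff algebra_simps)
    then show ?thesis by (simp only: homogeneous_ev[OF f] p p0 poly_0 mult_zero_right)
  qed
qed

section \<open>Projective geometry and modular points\<close>

lemma proj_point_subset_eq: "proj_point p \<Longrightarrow> proj_point q \<Longrightarrow> p \<subseteq> q \<Longrightarrow> p = q"
  unfolding proj_point_def by (intro vec.subspace_dim_equal) auto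

lemma proj_line_subset_eq: "proj_line H \<Longrightarrow> proj_line K \<Longrightarrow> H \<subseteq> K \<Longrightarrow> H = K"
  unfolding proj_line_def by (intro vec.subspace_dim_equal) auto

text \<open>Dimension formula: planes in 3-space meet in dimension at least
  \<open>2 + 2 - 3\<close>.\<close>

lemma proj_point_Int:
  assumes "proj_line H" "proj_line K" "H \<noteq> K"
  shows "proj_point (H \<inter> K)"
proof -
  have H: "vec.subspace H" "vec.dim H = 2" and K: "vec.subspace K" "vec.dim K = 2"
    using assms by (auto simp: proj_line_def)
  have HK: "vec.subspace (H \<inter> K)" using H(1) K(1) by (rule vec.subspace_inter)
  have "vec.dim (H \<inter> K) < 2"
  proof (rule ccontr)
    assume "\<not> ?thesis"
    then have "H \<inter> K = H" "H \<inter> K = K"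
      using H K HK by (simp_all add: vec.subspace_dim_equal)
    then show False using assms(3) by auto
  qed
  moreover have "vec.dim {x + y |x y. x \<in> H \<and> y \<in> K} \<le> vec.dim (UNIV :: (complex^3) set)"
    by (rule vec.dim_subset) simp
  then have "vec.dim {x + y |x y. x \<in> H \<and> y \<in> K} \<le> 3" by (simp only: vec_dim_card) simp
  then have "vec.dim (H \<inter> K) \<ge> 1"
    using vec.dim_sums_Int[OF H(1) K(1)] H(2) K(2) by linarith
  ultimately show ?thesis using HK by (simp add: proj_point_def)
qed

lemma proj_point_eq_Int:
  assumes "proj_line H" "proj_line K" "H \<noteq> K" "proj_point p" "p \<subseteq> H" "p \<subseteq> K"
  shows "p = H \<inter> K"
  using assms proj_point_Int[of H K] proj_point_subset_eq[of p "H \<inter> K"] by simp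

lemma proj_point_obtain:
  assumes "proj_point p"
  obtains w where "w \<noteq> 0" "p = range (\<lambda>c. c *s w)"
proof -
  have p: "vec.subspace p" "vec.dim p = 1" using assms by (auto simp: proj_point_def)
  obtain B where B: "B \<subseteq> p" "vec.independent B" "p \<subseteq> vec.span B" "card B = 1"
    using vec.basis_exists[of p] p(2) by metis
  then obtain w where w: "B = {w}" by (auto simp: card_1_singleton_iff)
  have "w \<noteq> 0" using B(2) w vec.dependent_zero by blast
  moreover have "p = vec.span {w}"
    using B w p(1) vec.span_minimal[of B p] by auto
  ultimately show ?thesis using that by (simp add: vec.span_singleton)
qed

lemma proj_point_range: "w \<noteq> 0 \<Longrightarrow> proj_point (range (\<lambda>c. c *s w))"
  unfolding vec.span_singleton[symmetric] proj_point_def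
  using vec.dim_span_eq_card_independent[of "{w}"] by (simp add: vec.independent_insert del: vec.dim_span)

lemma range_smult_subset_iff:
  "vec.subspace H \<Longrightarrow> range (\<lambda>c. c *s w) \<subseteq> H \<longleftrightarrow> w \<in> H"
proof
  assume "range (\<lambda>c. c *s w) \<subseteq> H"
  then have "1 *s w \<in> H" by blast
  then show "w \<in> H" by simp
qed (auto intro: vec.subspace_scale)

lemma proj_line_span:
  assumes "proj_point p" "proj_point q" "p \<noteq> q"
  shows "proj_line (vec.span (p \<union> q))"
proof -
  have p: "vec.subspace p" "vec.dim p = 1" and q: "vec.subspace q" "vec.dim q = 1"
    using assms by (auto simp: proj_point_def)
  have "vec.dim (p \<inter> q) = 0"
  proof (rule ccontr)
    assume "vec.dim (p \<inter> q) \<noteq> 0"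
    then have "vec.dim (p \<inter> q) \<ge> 1" by linarith
    then have "p \<inter> q = p" "p \<inter> q = q"
      using p q vec.subspace_inter[of p q] by (simp_all add: vec.subspace_dim_equal)
    then show False using assms(3) by auto
  qed
  then have "vec.dim {x + y |x y. x \<in> p \<and> y \<in> q} = 2"
    using vec.dim_sums_Int[OF p(1) q(1)] p(2) q(2) by linarith
  moreover have "vec.span (p \<union> q) = {x + y |x y. x \<in> p \<and> y \<in> q}"
    using p(1) q(1) by (simp add: vec.span_Un vec.span_eq_iff[THEN iffD2])
  ultimately show ?thesis unfolding proj_line_def by (metis vec.subspace_span)
qed

lemma proj_line_eq_span:
  assumes "proj_point p" "proj_point q" "p \<noteq> q" "proj_line H" "p \<subseteq> H" "q \<subseteq> H"
  shows "H = vec.span (p \<union> q)"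
proof -
  have "vec.span (p \<union> q) \<subseteq> H"
    using assms by (intro vec.span_minimal) (auto simp: proj_line_def)
  then show ?thesis using proj_line_subset_eq[OF proj_line_span[OF assms(1-3)] assms(4)] by simp
qed

section \<open>Intersection points and the count of double points\<close>

lemma intersection_pointI:
  assumes "finite A" "H \<in> A" "K \<in> A" "H \<noteq> K" "proj_point p" "p \<subseteq> H" "p \<subseteq> K"
  shows "p \<in> intersection_points A"
proof -
  have "card {H, K} \<le> point_mult A p"
    unfolding point_mult_def using assms by (intro card_mono) auto
  then show ?thesis using assms by (simp add: intersection_points_def)
qed

lemma intersection_pointE:
  assumes "p \<in> intersection_points A"
  obtains H K where "H \<in> A" "K \<in> A" "H \<noteq> K" "p \<subseteq> H" "p \<subseteq> K"
proof -
  have "card {H \<in> A. p \<subseteq> H} \<ge> 2" using assms by (simp add: intersection_points_def point_mult_def)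
  then obtain T where T: "T \<subseteq> {H \<in> A. p \<subseteq> H}" "card T = 2" by (rule obtain_subset_with_card_n)
  then obtain H K where "T = {H, K}" "H \<noteq> K" by (meson card_2_iff)
  then show ?thesis using that[of H K] T by simp
qed

lemma finite_intersection_points:
  assumes "line_arrangement A"
  shows "finite (intersection_points A)"
proof (rule finite_subset)
  show "intersection_points A \<subseteq> (\<lambda>(H, K). H \<inter> K) ` (A \<times> A)"
  proof
    fix p assume p: "p \<in> intersection_points A"
    then obtain H K where HK: "H \<in> A" "K \<in> A" "H \<noteq> K" "p \<subseteq> H" "p \<subseteq> K"
      by (rule intersection_pointE)
    then have "p = H \<inter> K"
      using p assms by (intro proj_point_eq_Int) (auto simp: intersection_points_def line_arrangement_def)
    then show "p \<in> (\<lambda>(H, K). H \<inter> K) ` (A \<times> A)" using HK by auto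
  qed
qed (use assms in \<open>auto simp: line_arrangement_def\<close>)

text \<open>Two lines through \<open>p\<close> meeting \<open>L\<close> in the same point would
  share both \<open>p\<close> and that point, which puts \<open>p\<close> on
  \<open>L\<close>.\<close>

lemma inj_on_Int_pencil:
  assumes "line_arrangement A" "proj_point p" "L \<in> A" "\<not> p \<subseteq> L"
  shows "inj_on (\<lambda>H. H \<inter> L) {H \<in> A. p \<subseteq> H}"
proof (rule inj_onI, rule ccontr)
  have lines: "\<And>H. H \<in> A \<Longrightarrow> proj_line H" using assms(1) by (simp add: line_arrangement_def)
  fix H K assume HK: "H \<in> {H \<in> A. p \<subseteq> H}" "K \<in> {H \<in> A. p \<subseteq> H}" "H \<inter> L = K \<inter> L" "H \<noteq> K"
  then have "p = H \<inter> K" using assms(2) lines by (intro proj_point_eq_Int) auto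
  moreover have "H \<inter> L \<subseteq> H \<inter> K" using HK(3) by auto
  moreover have "proj_point (H \<inter> L)" using HK(1) assms lines by (intro proj_point_Int) auto
  ultimately have "H \<inter> L = p" using assms(2) by (intro proj_point_subset_eq) auto
  then show False using assms(4) by auto
qed

text \<open>The other lines are sorted by their meet with \<open>L\<close>. There are exactly
  \<open>point_mult A p\<close> classes, of size one at double points and at least two elsewhere,
  and the sizes add up to \<open>card A - 1\<close>.\<close>

lemma modular_line_double_points:
  assumes arr: "line_arrangement A" and mod: "modular_point A p"
    and L: "L \<in> A" "\<not> p \<subseteq> L"
  shows "2 * point_mult A p + 1 \<le> card A + card {q \<in> double_points A. q \<subseteq> L}"
proof -
  have fin: "finite A" and lines: "\<And>H. H \<in> A \<Longrightarrow> proj_line H"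
    using arr by (auto simp: line_arrangement_def)
  have p: "proj_point p" using mod by (auto simp: modular_point_def intersection_points_def)
  define Ap where "Ap = {H \<in> A. p \<subseteq> H}"
  define g where "g H = H \<inter> L" for H
  define D where "D = {q \<in> double_points A. q \<subseteq> L}"
  have finD: "finite D"
    using finite_intersection_points[OF arr] by (simp add: D_def double_points_def)
  have gpt: "proj_point (g H)" if "H \<in> A - {L}" for H
    using that L lines unfolding g_def by (intro proj_point_Int) auto
  have gint: "g H \<in> intersection_points A" if "H \<in> A - {L}" for H
    using that L gpt[OF that] fin by (intro intersection_pointI[of A H L]) (auto simp: g_def)
  have ApA: "Ap \<subseteq> A - {L}" using L by (auto simp: Ap_def)
  have inj: "inj_on g Ap"
    unfolding g_def Ap_def by (rule inj_on_Int_pencil[OF arr p L])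
  \<comment> \<open>Modularity enters here: an intersection point on \<open>L\<close> is joined to
    \<open>p\<close> by a line of the arrangement, so every meet with \<open>L\<close> comes from a
    line through \<open>p\<close>.\<close>
  have img: "g ` (A - {L}) = g ` Ap"
  proof
    show "g ` (A - {L}) \<subseteq> g ` Ap"
    proof
      fix q assume "q \<in> g ` (A - {L})"
      then obtain H where H: "H \<in> A - {L}" "q = g H" by auto
      then have q: "q \<in> intersection_points A" "q \<subseteq> L" "proj_point q"
        using gint gpt by (auto simp: g_def)
      then have "q \<noteq> p" using L by auto
      then have K: "vec.span (p \<union> q) \<in> A" using mod q by (auto simp: modular_point_def)
      have sub: "p \<subseteq> vec.span (p \<union> q)" "q \<subseteq> vec.span (p \<union> q)"
        using vec.span_superset[of "p \<union> q"] by auto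
      then have "vec.span (p \<union> q) \<in> Ap" using K by (simp add: Ap_def)
      moreover have "q = g (vec.span (p \<union> q))"
        unfolding g_def using sub K q L lines by (intro proj_point_eq_Int) auto
      ultimately show "q \<in> g ` Ap" by auto
    qed
  qed (use ApA in auto)
  \<comment> \<open>\<open>L\<close> itself passes through \<open>q\<close>, so the class has one
    element fewer than the multiplicity.\<close>
  have fib: "(if q \<in> D then 1 else 2) \<le> card {H \<in> A - {L}. g H = q}" if "q \<in> g ` Ap" for q
  proof -
    have q: "q \<in> intersection_points A" "q \<subseteq> L" "proj_point q"
      using that gint gpt ApA by (auto simp: g_def)
    have "g H = q \<longleftrightarrow> q \<subseteq> H" if "H \<in> A - {L}" for H
      using that q L lines proj_point_eq_Int[of H L q] by (auto simp: g_def)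
    then have "{H \<in> A - {L}. g H = q} = {H \<in> A. q \<subseteq> H} - {L}" by blast
    then have "card {H \<in> A - {L}. g H = q} = point_mult A q - 1"
      using L q fin by (simp add: point_mult_def)
    moreover have "point_mult A q \<ge> 2" using q by (simp add: intersection_points_def)
    ultimately show ?thesis using q by (auto simp: D_def double_points_def)
  qed
  have "2 * point_mult A p = (\<Sum>q\<in>g ` Ap. 2)"
    using inj by (simp add: card_image point_mult_def Ap_def)
  also have "\<dots> = (\<Sum>q\<in>g ` Ap. if q \<in> D then 1 else 2) + (\<Sum>q\<in>g ` Ap. if q \<in> D then 1 else 0)"
    by (subst sum.distrib[symmetric]) (rule sum.cong, auto)
  also have "(\<Sum>q\<in>g ` Ap. if q \<in> D then 1 else 2) \<le> (\<Sum>q\<in>g ` Ap. card {H \<in> A - {L}. g H = q})"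
    by (rule sum_mono) (rule fib)
  also have "\<dots> = card (A - {L})"
    using sum.image_gen[of "A - {L}" "\<lambda>_. 1::nat" g] fin img by simp
  also have "(\<Sum>q\<in>g ` Ap. if q \<in> D then 1 else 0) = card (g ` Ap \<inter> D)"
    using fin by (simp add: sum.If_cases Ap_def)
  also have "\<dots> \<le> card D" using finD by (intro card_mono) auto
  finally have "2 * point_mult A p \<le> card (A - {L}) + card D" by simp
  moreover have "card A = Suc (card (A - {L}))" using fin L by (metis card_Suc_Diff1)
  ultimately show ?thesis by (simp add: D_def)
qed

text \<open>The previous bound is summed over the lines missing \<open>p\<close>. A double point on
  two of them would also lie on its join with \<open>p\<close>, a third line, so nothing is counted
  twice. Integers are used because the second factor can be negative.\<close>

lemma modular_double_points_bound:
  assumes arr: "line_arrangement A" and mod: "modular_point A p"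
  shows "(int (card A) - int (point_mult A p)) * (2 * int (point_mult A p) - int (card A) + 1)
    \<le> int (card (double_points A))"
proof -
  have fin: "finite A" and lines: "\<And>H. H \<in> A \<Longrightarrow> proj_line H"
    using arr by (auto simp: line_arrangement_def)
  define R where "R = {H \<in> A. \<not> p \<subseteq> H}"
  define D where "D L = {q \<in> double_points A. q \<subseteq> L}" for L
  have finD: "finite (double_points A)"
    using finite_intersection_points[OF arr] by (simp add: double_points_def)
  have disj: "D L \<inter> D L' = {}" if LL: "L \<in> R" "L' \<in> R" "L \<noteq> L'" for L L'
  proof (rule ccontr)
    assume "D L \<inter> D L' \<noteq> {}"
    then obtain q where q: "q \<in> double_points A" "q \<subseteq> L" "q \<subseteq> L'" by (auto simp: D_def)
    let ?K = "vec.span (p \<union> q)"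
    have "q \<noteq> p" using q LL by (auto simp: R_def)
    then have "?K \<in> A" using mod q by (auto simp: modular_point_def double_points_def)
    moreover have "p \<subseteq> ?K" "q \<subseteq> ?K" using vec.span_superset[of "p \<union> q"] by auto
    ultimately have "card {?K, L, L'} \<le> point_mult A q"
      unfolding point_mult_def using fin q LL by (intro card_mono) (auto simp: R_def)
    moreover have "?K \<noteq> L" "?K \<noteq> L'" using LL \<open>p \<subseteq> ?K\<close> by (auto simp: R_def)
    ultimately show False using q LL by (simp add: double_points_def)
  qed
  have "card A = card ({H \<in> A. p \<subseteq> H} \<union> R)"
    by (rule arg_cong[of _ _ card]) (auto simp: R_def)
  also have "\<dots> = card {H \<in> A. p \<subseteq> H} + card R"
    using fin by (intro card_Un_disjoint) (auto simp: R_def)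
  finally have "card {H \<in> A. p \<subseteq> H} + card R = card A" by simp
  then have "int (card A) - int (point_mult A p) = int (card R)"
    by (simp add: point_mult_def)
  then have "(int (card A) - int (point_mult A p)) * (2 * int (point_mult A p) - int (card A) + 1)
     = (\<Sum>L\<in>R. 2 * int (point_mult A p) - int (card A) + 1)" by simp
  also have "\<dots> \<le> (\<Sum>L\<in>R. int (card (D L)))"
  proof (rule sum_mono)
    fix L assume "L \<in> R"
    then show "2 * int (point_mult A p) - int (card A) + 1 \<le> int (card (D L))"
      using modular_line_double_points[OF arr mod, of L] by (simp add: R_def D_def)
  qed
  also have "\<dots> = int (card (\<Union>L\<in>R. D L))"
    using finD fin disj by (subst card_UN_disjoint) (auto simp: R_def D_def)
  also have "\<dots> \<le> int (card (double_points A))"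
    using finD by (intro of_nat_mono card_mono) (auto simp: D_def)
  finally show ?thesis .
qed

section \<open>Fields tangent to an arrangement\<close>

definition det3 :: "'a::comm_ring_1^3 \<Rightarrow> 'a^3 \<Rightarrow> 'a^3 \<Rightarrow> 'a" where
  "det3 u v w = u$1 * (v$2 * w$3 - v$3 * w$2) - u$2 * (v$1 * w$3 - v$3 * w$1)
     + u$3 * (v$1 * w$2 - v$2 * w$1)"

lemma det3_add:
  "det3 (x + x') y z = det3 x y z + det3 x' y z"
  "det3 x (y + y') z = det3 x y z + det3 x y' z"
  "det3 x y (z + z') = det3 x y z + det3 x y z'"
  by (simp_all add: det3_def algebra_simps)

lemma det3_smult:
  "det3 (c *s x) y z = c * det3 x y z"
  "det3 x (c *s y) z = c * det3 x y z"
  "det3 x y (c *s z) = c * det3 x y z"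
  by (simp_all add: det3_def algebra_simps)

lemma det3_zero [simp]:
  "det3 0 y z = 0" "det3 x 0 z = 0" "det3 x y 0 = 0"
  by (simp_all add: det3_def)

lemma det3_repeat [simp]:
  "det3 x x y = 0" "det3 x y x = 0" "det3 y x x = 0"
  by (simp_all add: det3_def algebra_simps)

lemma det3_permute:
  "det3 x z y = - det3 x y z" "det3 y x z = - det3 x y z" "det3 z y x = - det3 x y z"
  "det3 y z x = det3 x y z" "det3 z x y = det3 x y z"
  by (simp_all add: det3_def algebra_simps)

lemma det3_sum:
  "det3 (sum f I) y z = (\<Sum>i\<in>I. det3 (f i) y z)"
  "det3 x (sum f I) z = (\<Sum>i\<in>I. det3 x (f i) z)"
  "det3 x y (sum f I) = (\<Sum>i\<in>I. det3 x y (f i))"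
  by (induction I rule: infinite_finite_induct; simp add: det3_add)+

text \<open>Cramer's rule without division, hence valid over \<open>S\<close>.\<close>

lemma cramer3:
  "det3 b1 b2 b3 *s x = det3 x b2 b3 *s b1 + det3 b1 x b3 *s b2 + det3 b1 b2 x *s b3"
  by (simp add: vec_eq_iff forall_3 det3_def algebra_simps)

text \<open>A coordinate of \<open>a\<close> times the determinant is a combination of the three
  pairings with \<open>a\<close>, and some coordinate is nonzero.\<close>

lemma det3_eq_0_if_common_kernel:
  fixes a :: "'a::idom^3"
  assumes "a \<noteq> 0" "dot3 a u = 0" "dot3 a v = 0" "dot3 a w = 0"
  shows "det3 u v w = 0"
proof -
  have "a$1 * det3 u v w = dot3 a u * (v$2 * w$3 - v$3 * w$2) - dot3 a v * (u$2 * w$3 - u$3 * w$2)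
      + dot3 a w * (u$2 * v$3 - u$3 * v$2)"
    by (simp add: det3_def dot3_def algebra_simps)
  moreover have "a$2 * det3 u v w = - dot3 a u * (v$1 * w$3 - v$3 * w$1) + dot3 a v * (u$1 * w$3 - u$3 * w$1)
      - dot3 a w * (u$1 * v$3 - u$3 * v$1)"
    by (simp add: det3_def dot3_def algebra_simps)
  moreover have "a$3 * det3 u v w = dot3 a u * (v$1 * w$2 - v$2 * w$1) - dot3 a v * (u$1 * w$2 - u$2 * w$1)
      + dot3 a w * (u$1 * v$2 - u$2 * v$1)"
    by (simp add: det3_def dot3_def algebra_simps)
  ultimately show ?thesis using assms by (auto simp: vec_eq_iff forall_3)
qed

lemma dvd_det3_span:
  assumes B: "\<And>x y z. x \<in> B \<Longrightarrow> y \<in> B \<Longrightarrow> z \<in> B \<Longrightarrow> k dvd det3 x y z"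
    and "x \<in> DerS.span B" "y \<in> DerS.span B" "z \<in> DerS.span B"
  shows "k dvd det3 x y z"
proof -
  have 1: "k dvd det3 x y z" if "x \<in> DerS.span B" "y \<in> B" "z \<in> B" for x y z
    using that(1)
    by (induction rule: DerS.span_induct_alt) (use B that in \<open>auto simp: det3_add det3_smult\<close>)
  have 2: "k dvd det3 x y z" if "x \<in> DerS.span B" "y \<in> DerS.span B" "z \<in> B" for x y z
    using that(2)
    by (induction rule: DerS.span_induct_alt) (use 1 that in \<open>auto simp: det3_add det3_smult\<close>)
  show ?thesis
    using assms(4)
    by (induction rule: DerS.span_induct_alt) (use 2 assms in \<open>auto simp: det3_add det3_smult\<close>)
qed

definition ev_field :: "S^3 \<Rightarrow> complex^3 \<Rightarrow> complex^3" where
  "ev_field \<theta> v = (\<chi> i. ev (\<theta>$i) v)"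

lemma ev_field_nth [simp]: "ev_field \<theta> v $ i = ev (\<theta>$i) v"
  by (simp add: ev_field_def)

lemma ev_field_add [simp]: "ev_field (\<theta> + \<eta>) v = ev_field \<theta> v + ev_field \<eta> v"
  and ev_field_smult [simp]: "ev_field (f *s \<theta>) v = ev f v *s ev_field \<theta> v"
  and ev_field_0 [simp]: "ev_field 0 v = 0"
  by (simp_all add: vec_eq_iff)

lemma ev_det3 [simp]: "ev (det3 x y z) v = det3 (ev_field x v) (ev_field y v) (ev_field z v)"
  by (simp add: det3_def)

definition const_field :: "complex^3 \<Rightarrow> S^3" where
  "const_field w = (\<chi> i. const (w$i))"

lemma ev_field_const_field [simp]: "ev_field (const_field w) v = w"
  by (simp add: const_field_def vec_eq_iff)

definition euler :: "S^3" where
  "euler = vector [varx, vary, varz]"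

lemma ev_field_euler [simp]: "ev_field euler v = v"
  by (simp add: euler_def vec_eq_iff forall_3)

lemma ev_field_eqI: "(\<And>v. ev_field \<theta> v = ev_field \<eta> v) \<Longrightarrow> \<theta> = \<eta>"
  by (simp add: vec_eq_iff) (metis S_eqI)

lemma dot3_axis [simp]: "dot3 a (axis i 1) = a$i"
  using exhaust_3[of i] by (auto simp: dot3_def axis_def)

lemma subspace_ker3: "vec.subspace (ker3 a)"
  by (auto simp: vec.subspace_def mem_ker3) (simp add: dot3_def)

lemma proj_line_subspace: "proj_line H \<Longrightarrow> vec.subspace H"
  by (simp add: proj_line_def)

section \<open>Cross products, normal vectors and the forms of lines\<close>

definition cross :: "'a::comm_ring_1^3 \<Rightarrow> 'a^3 \<Rightarrow> 'a^3" where
  "cross u v = vector [u$2 * v$3 - u$3 * v$2, u$3 * v$1 - u$1 * v$3, u$1 * v$2 - u$2 * v$1]"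

lemma det3_eq_dot3_cross: "det3 u v w = dot3 (cross u v) w"
  by (simp add: det3_def dot3_def cross_def algebra_simps)

lemma cross_eq_0D:
  fixes u v :: "complex^3"
  assumes "cross u v = 0" "u \<noteq> 0"
  shows "\<exists>c. v = c *s u"
proof -
  have a: "u$2 * v$3 = u$3 * v$2" "u$3 * v$1 = u$1 * v$3" "u$1 * v$2 = u$2 * v$1"
    using assms(1) by (auto simp: cross_def vec_eq_iff forall_3)
  obtain i where i: "u$i \<noteq> 0" using assms(2) by (auto simp: vec_eq_iff)
  have "\<forall>j. u$i * v$j = u$j * v$i"
    using a exhaust_3[of i] by (auto simp: forall_3)
  then have "v = (v$i / u$i) *s u"
    using i by (simp add: vec_eq_iff field_simps)
  then show ?thesis by blast
qed

lemma proj_line_basis: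
  assumes "proj_line H"
  obtains u v where "u \<in> H" "v \<in> H" "cross u v \<noteq> 0" "H \<subseteq> vec.span {u, v}"
proof -
  have H: "vec.subspace H" "vec.dim H = 2" using assms by (auto simp: proj_line_def)
  obtain B where B: "B \<subseteq> H" "vec.independent B" "H \<subseteq> vec.span B" "card B = 2"
    using vec.basis_exists[of H] H(2) by metis
  then obtain u v where uv: "B = {u, v}" "u \<noteq> v" by (meson card_2_iff)
  have "cross u v \<noteq> 0"
  proof
    assume "cross u v = 0"
    moreover have "u \<noteq> 0" using B(2) uv vec.dependent_zero by blast
    ultimately obtain c where "v = c *s u" using cross_eq_0D by blast
    moreover have "c *s u \<in> vec.span (B - {v})"
      using uv by (intro vec.span_scale vec.span_base) auto
    ultimately have "v \<in> vec.span (B - {v})" by metis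
    moreover have "v \<in> B" using uv by simp
    ultimately show False using B(2) unfolding vec.dependent_def by blast
  qed
  then show ?thesis using that[of u v] B uv by simp
qed

text \<open>The cross product of a basis pairs to zero with both basis vectors, so its kernel
  contains \<open>H\<close>; being a proper subspace, this kernel has dimension at most 2.\<close>

lemma proj_line_ker3:
  assumes "proj_line H"
  obtains u v where "u \<in> H" "v \<in> H" "cross u v \<noteq> 0" "H = ker3 (cross u v)"
proof -
  have H: "vec.subspace H" "vec.dim H = 2" using assms by (auto simp: proj_line_def)
  obtain u v where uv: "u \<in> H" "v \<in> H" "cross u v \<noteq> 0" "H \<subseteq> vec.span {u, v}"
    using proj_line_basis[OF assms] by metis
  define a where "a = cross u v"
  have "a \<noteq> 0" using uv by (simp add: a_def)
  moreover have "H = ker3 a"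
  proof (rule vec.subspace_dim_equal[OF H(1) subspace_ker3])
    have "{u, v} \<subseteq> ker3 a" by (auto simp: a_def cross_def mem_ker3 dot3_def algebra_simps)
    then show "H \<subseteq> ker3 a" using uv(4) vec.span_minimal[OF _ subspace_ker3] by blast
    have "ker3 a \<noteq> UNIV"
    proof
      assume "ker3 a = UNIV"
      then have "a$i = 0" for i using mem_ker3[of "axis i 1" a] by simp
      then show False using \<open>a \<noteq> 0\<close> by (simp add: vec_eq_iff)
    qed
    then have "vec.dim (ker3 a) \<noteq> CARD(3)"
      using vec.subspace_dim_equal[OF subspace_ker3 vec.subspace_UNIV, of a] vec_dim_card[where 'a = complex and 'n = 3]
      by auto
    moreover have "vec.dim (ker3 a) \<le> vec.dim (UNIV :: (complex^3) set)"
      by (rule vec.dim_subset) simp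
    then have "vec.dim (ker3 a) \<le> CARD(3)" by (simp only: vec_dim_card)
    ultimately show "vec.dim (ker3 a) \<le> vec.dim H" using H(2) by simp
  qed
  ultimately show ?thesis using that[OF uv(1-3)] by (simp add: a_def)
qed

definition normal_vec :: "(complex^3) set \<Rightarrow> complex^3" where
  "normal_vec H = (SOME a. a \<noteq> 0 \<and> H = ker3 a)"

definition line_form :: "(complex^3) set \<Rightarrow> S" where
  "line_form H = linear_form (normal_vec H)"

lemma normal_vec:
  assumes "proj_line H"
  shows "normal_vec H \<noteq> 0" "ker3 (normal_vec H) = H"
proof -
  have "\<exists>a. a \<noteq> 0 \<and> H = ker3 a" using proj_line_ker3[OF assms] by metis
  then have "normal_vec H \<noteq> 0 \<and> H = ker3 (normal_vec H)" unfolding normal_vec_def by (rule someI_ex)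
  then show "normal_vec H \<noteq> 0" "ker3 (normal_vec H) = H" by auto
qed

lemma mem_proj_line: "proj_line H \<Longrightarrow> v \<in> H \<longleftrightarrow> dot3 (normal_vec H) v = 0"
  using normal_vec(2)[of H] mem_ker3 by blast

lemma line_form_ev: "proj_line H \<Longrightarrow> ev (line_form H) v = 0 \<longleftrightarrow> v \<in> H"
  by (simp add: line_form_def mem_proj_line)

lemma line_form_dvd_iff: "proj_line H \<Longrightarrow> line_form H dvd f \<longleftrightarrow> (\<forall>v\<in>H. ev f v = 0)"
  using linear_form_dvd_iff[OF normal_vec(1)] normal_vec(2) by (metis line_form_def)

lemma homogeneous_line_form: "homogeneous 1 (line_form H)"
  unfolding line_form_def by (rule homogeneous_linear_form)

text \<open>Divisibility by the form is vanishing on its kernel, which is irreducible by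
  \<open>vanish_prime\<close>.\<close>

lemma prime_linear_form:
  assumes "a \<noteq> 0"
  shows "prime_elem (linear_form a)"
proof (rule prime_elemI)
  show "linear_form a \<noteq> 0"
  proof
    assume "linear_form a = 0"
    then have "dot3 a v = 0" for v by (metis ev_linear_form ev_simps(1))
    from this[of "axis _ 1"] show False using assms by (simp add: vec_eq_iff)
  qed
  show "\<not> linear_form a dvd 1"
    using assms vec.subspace_0[OF subspace_ker3] by (auto simp: linear_form_dvd_iff)
  show "linear_form a dvd f \<or> linear_form a dvd g" if "linear_form a dvd f * g" for f g
    using that assms vanish_prime[OF subspace_ker3, of a f g] by (simp add: linear_form_dvd_iff)
qed

lemma prime_line_form: "proj_line H \<Longrightarrow> prime_elem (line_form H)"
  unfolding line_form_def by (rule prime_linear_form) (rule normal_vec)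

lemma line_form_dvd_line_form: "proj_line H \<Longrightarrow> proj_line K \<Longrightarrow> line_form H dvd line_form K \<Longrightarrow> H = K"
  using proj_line_subset_eq by (auto simp: line_form_dvd_iff line_form_ev)

text \<open>Each prime \<open>F t\<close> divides \<open>f\<close> times a cofactor but not
  \<open>f\<close>, so it divides the cofactor and cancels.\<close>

lemma dvd_cancel_primes:
  fixes f u :: "'a::idom"
  assumes "finite T" "\<And>t. t \<in> T \<Longrightarrow> prime_elem (F t)" "\<And>t. t \<in> T \<Longrightarrow> \<not> F t dvd f"
    "f dvd u * prod F T"
  shows "f dvd u"
  using assms
proof (induction T rule: finite_induct)
  case (insert t T)
  obtain h where h: "u * prod F (insert t T) = f * h" using insert.prems(3) by (auto elim: dvdE)
  then have eq: "F t * (u * prod F T) = f * h" using insert.hyps by (simp add: mult_ac)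
  then have "F t dvd f * h" by (metis dvd_triv_left)
  then have "F t dvd h" using insert.prems(1,2)[of t] by (auto simp: prime_elem_dvd_mult_iff)
  then obtain h' where "h = F t * h'" by (auto elim: dvdE)
  then have "F t * (u * prod F T) = F t * (f * h')" using eq by (simp add: mult_ac)
  then have "u * prod F T = f * h'" using insert.prems(1)[of t] by auto
  then show ?case using insert by auto
qed simp

lemma prime_dvd_prodD:
  assumes "finite T" "prime_elem p" "p dvd prod F T"
  shows "\<exists>t\<in>T. p dvd F t"
  using assms
  by (induction T rule: finite_induct) (auto simp: prime_elem_dvd_mult_iff prime_elem_not_unit)

lemma unit_is_const: "f dvd 1 \<Longrightarrow> \<exists>c. c \<noteq> 0 \<and> f = const c" for f :: S
  by (auto simp: is_unit_poly_iff const_def)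

section \<open>The defining polynomial Q of an arrangement, fixed up to a nonzero constant\<close>

definition arr_poly :: "(complex^3) set set \<Rightarrow> S" where
  "arr_poly T = (\<Prod>H\<in>T. line_form H)"

lemma homogeneous_arr_poly: "finite T \<Longrightarrow> homogeneous (card T) (arr_poly T)"
  unfolding arr_poly_def by (auto intro: homogeneous_prod homogeneous_line_form)

lemma arr_poly_remove: "finite T \<Longrightarrow> H \<in> T \<Longrightarrow> arr_poly T = line_form H * arr_poly (T - {H})"
  unfolding arr_poly_def by (rule prod.remove)

lemma arr_poly_ne_0: "line_arrangement T \<Longrightarrow> arr_poly T \<noteq> 0"
  using prime_elem_not_zeroI[OF prime_line_form] by (auto simp: arr_poly_def line_arrangement_def)

lemma line_form_not_dvd_arr_poly:
  assumes "line_arrangement T" "proj_line H" "H \<notin> T"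
  shows "\<not> line_form H dvd arr_poly T"
proof
  assume "line_form H dvd arr_poly T"
  then have "\<exists>K\<in>T. line_form H dvd line_form K"
    using prime_dvd_prodD[of T "line_form H" line_form] prime_line_form[OF assms(2)] assms(1)
    by (simp add: arr_poly_def line_arrangement_def)
  then show False using line_form_dvd_line_form assms by (auto simp: line_arrangement_def)
qed

text \<open>Forms of distinct lines are primes not dividing one another, so divisibility by each
  accumulates to the product.\<close>

lemma arr_poly_dvd:
  assumes "line_arrangement T" "\<And>H v. H \<in> T \<Longrightarrow> v \<in> H \<Longrightarrow> ev f v = 0"
  shows "arr_poly T dvd f"
proof -
  have "finite T" using assms by (simp add: line_arrangement_def)
  then show ?thesis using assms
  proof (induction T rule: finite_induct)
    case (insert H T)
    have T: "line_arrangement T" and H: "proj_line H" using insert.prems by (auto simp: line_arrangement_def)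
    then have "arr_poly T dvd f" using insert by auto
    then obtain g where g: "f = arr_poly T * g" by (auto elim: dvdE)
    have "line_form H dvd arr_poly T * g"
      using insert.prems(2)[of H] H g by (simp add: line_form_dvd_iff)
    then have "line_form H dvd g"
      using line_form_not_dvd_arr_poly[OF T H] insert.hyps prime_line_form[OF H] by (auto simp: prime_elem_dvd_mult_iff)
    then have "line_form H * arr_poly T dvd g * arr_poly T" by (rule mult_dvd_mono) simp
    then show ?case using insert.hyps by (simp add: g arr_poly_def mult.commute)
  qed (simp add: arr_poly_def)
qed

section \<open>Derivations as tangent vector fields\<close>

lemma der_apply_linear_form:
  "der_apply \<theta> (linear_form a) = const (a$1) * \<theta>$1 + const (a$2) * \<theta>$2 + const (a$3) * \<theta>$3"
proof -
  have lf: "linear_form a = [:[:[:0, a$1:], [:a$2:]:], [:[:a$3:]:]:]"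
    by (simp add: linear_form_def const_def varx_def vary_def varz_def)
  have "dx (linear_form a) = const (a$1)" "dy (linear_form a) = const (a$2)"
    "dz (linear_form a) = const (a$3)"
    by (simp_all add: lf dx_def dy_def dz_def const_def map_poly_pCons pderiv_pCons)
  then show ?thesis by (simp add: der_apply_def mult.commute)
qed

lemma ev_der_apply_linear_form: "ev (der_apply \<theta> (linear_form a)) v = dot3 a (ev_field \<theta> v)"
  by (simp add: der_apply_linear_form dot3_def)

lemma ker3_0: "ker3 0 = UNIV"
  by (auto simp: mem_ker3 dot3_def)

text \<open>A linear form is its own differential: the value of
  \<open>der_apply \<theta> \<alpha>\<close> at \<open>v\<close> is \<open>\<alpha>\<close> applied
  to \<open>ev_field \<theta> v\<close>. Divisibility thus becomes tangency to
  \<open>H\<close>.\<close>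

lemma derivation_module_iff:
  assumes "line_arrangement A"
  shows "\<theta> \<in> derivation_module A \<longleftrightarrow> (\<forall>H\<in>A. \<forall>v\<in>H. ev_field \<theta> v \<in> H)"
proof -
  have "(\<forall>\<alpha>. defining_form H \<alpha> \<longrightarrow> \<alpha> dvd der_apply \<theta> \<alpha>) \<longleftrightarrow> (\<forall>v\<in>H. ev_field \<theta> v \<in> H)"
    if "H \<in> A" for H
  proof -
    have H: "proj_line H" using assms that by (simp add: line_arrangement_def)
    have df: "defining_form H \<alpha> \<longleftrightarrow> (\<exists>a. \<alpha> = linear_form a \<and> H = ker3 a)" for \<alpha>
      by (simp add: defining_form_def ker3_def dot3_def)
    \<comment> \<open>The zero form has the whole space as kernel, too large for a line.\<close>
    have ne: "a \<noteq> 0" if "H = ker3 a" for a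
      using that H vec_dim_card[where 'a = complex and 'n = 3]
      by (auto simp: proj_line_def ker3_0)
    have iff: "linear_form a dvd der_apply \<theta> (linear_form a) \<longleftrightarrow> (\<forall>v\<in>H. ev_field \<theta> v \<in> H)"
      if "H = ker3 a" for a
      unfolding linear_form_dvd_iff[OF ne[OF that]] ev_der_apply_linear_form that
      by (simp add: mem_ker3)
    have "H = ker3 (normal_vec H)" using normal_vec(2)[OF H] by simp
    then show ?thesis unfolding df using iff by metis
  qed
  then show ?thesis by (auto simp: derivation_module_def)
qed

section \<open>Saito's criterion\<close>

definition homogeneous_field :: "nat \<Rightarrow> S^3 \<Rightarrow> bool" where
  "homogeneous_field n \<theta> \<longleftrightarrow> (\<forall>i. homogeneous n (\<theta>$i))"

lemma homogeneous_field_ev: "homogeneous_field n \<theta> \<Longrightarrow> ev_field \<theta> (t *s v) = t ^ n *s ev_field \<theta> v"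
  by (simp add: homogeneous_field_def vec_eq_iff homogeneous_ev)

lemma homogeneous_det3:
  assumes "homogeneous_field a x" "homogeneous_field b y" "homogeneous_field c z"
  shows "homogeneous (a + b + c) (det3 x y z)"
  unfolding homogeneous_def ev_det3
  by (simp add: assms[THEN homogeneous_field_ev] det3_smult power_add mult_ac)

lemma homogeneous_field_decomp:
  "\<exists>c N. (\<forall>k. homogeneous_field k (c k)) \<and> \<theta> = (\<Sum>k\<le>N. c k)"
proof -
  have "\<forall>i. \<exists>c N. (\<forall>k. homogeneous k (c k)) \<and> (\<forall>k>N. c k = 0) \<and> \<theta>$i = (\<Sum>k\<le>N. c k)"
    using homogeneous_decomp by blast
  then obtain C N where C: "\<And>i k. homogeneous k (C i k)" "\<And>i k. k > N i \<Longrightarrow> C i k = 0"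
    "\<And>i. \<theta>$i = (\<Sum>k\<le>N i. C i k)" by metis
  define M where "M = (\<Sum>i\<in>UNIV. N i)"
  have "\<theta>$i = (\<Sum>k\<le>M. C i k)" for i
  proof -
    have "N i \<le> M" unfolding M_def by (rule member_le_sum) auto
    then show ?thesis unfolding C(3) by (intro sum.mono_neutral_left) (auto simp: C(2))
  qed
  then have "\<theta> = (\<Sum>k\<le>M. \<chi> i. C i k)" by (simp add: vec_eq_iff sum_component)
  moreover have "homogeneous_field k (\<chi> i. C i k)" for k by (simp add: homogeneous_field_def C(1))
  ultimately show ?thesis by (intro exI[of _ "\<lambda>k. \<chi> i. C i k"] exI[of _ M] conjI allI)
qed

lemma dot3_sum: "dot3 a (sum f I) = (\<Sum>i\<in>I. dot3 a (f i))"
  by (induction I rule: infinite_finite_induct) (auto simp: dot3_def algebra_simps)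

lemma ev_field_sum: "ev_field (sum f I) v = (\<Sum>i\<in>I. ev_field (f i) v)"
  by (induction I rule: infinite_finite_induct) auto

text \<open>Planes are closed under scaling, so tangency at all \<open>t *s v\<close> is a
  polynomial identity in \<open>t\<close>, whose coefficients are the tangency conditions of the
  components. This is the grading of the module.\<close>

lemma derivation_module_components:
  assumes arr: "line_arrangement A" and c: "\<And>k. homogeneous_field k (c k)"
    and \<theta>: "(\<Sum>k\<le>N. c k) \<in> derivation_module A" and k: "k \<le> N"
  shows "c k \<in> derivation_module A"
  unfolding derivation_module_iff[OF arr]
proof (intro ballI)
  fix H v assume H: "H \<in> A" and v: "v \<in> H"
  have line: "proj_line H" using arr H by (simp add: line_arrangement_def)
  have "(\<Sum>k\<le>N. dot3 (normal_vec H) (ev_field (c k) v) * t ^ k) = (\<Sum>k\<le>N. 0 * t ^ k)" for t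
  proof -
    have "t *s v \<in> H" using v line by (simp add: proj_line_def vec.subspace_scale)
    then have "ev_field (\<Sum>k\<le>N. c k) (t *s v) \<in> H"
      using \<theta> H by (simp add: derivation_module_iff[OF arr])
    then show ?thesis
      using line by (simp add: mem_proj_line ev_field_sum dot3_sum homogeneous_field_ev[OF c] mult.commute)
  qed
  then have "dot3 (normal_vec H) (ev_field (c k) v) = 0" using k by (rule power_sum_coeffs_eq)
  then show "ev_field (c k) v \<in> H" using line by (simp add: mem_proj_line)
qed

lemma euler_mem: "line_arrangement A \<Longrightarrow> euler \<in> derivation_module A"
  by (simp add: derivation_module_iff)

lemma homogeneous_field_euler: "homogeneous_field 1 euler"
  using homogeneous_varx homogeneous_vary homogeneous_varz by (simp add: homogeneous_field_def forall_3 euler_def)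

text \<open>On a line containing \<open>w\<close> the constant direction is tangent; on the others
  the factor kills the field. This is the source of explicit tangent fields.\<close>

lemma constant_field_mem:
  assumes "line_arrangement A" "\<And>H v. H \<in> A \<Longrightarrow> w \<notin> H \<Longrightarrow> v \<in> H \<Longrightarrow> ev f v = 0"
  shows "f *s const_field w \<in> derivation_module A"
  unfolding derivation_module_iff[OF assms(1)]
proof (intro ballI)
  fix H v assume H: "H \<in> A" "v \<in> H"
  have "vec.subspace H" using assms(1) H by (simp add: line_arrangement_def proj_line_def)
  then show "ev_field (f *s const_field w) v \<in> H"
    using assms(2)[of H v] H by (cases "w \<in> H") (auto simp: vec.subspace_scale vec.subspace_0)
qed

lemma ev_arr_poly_eq_0: "line_arrangement T \<Longrightarrow> H \<in> T \<Longrightarrow> v \<in> H \<Longrightarrow> ev (arr_poly T) v = 0"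
  by (auto simp: arr_poly_def line_arrangement_def line_form_ev)

lemma line_arrangement_subset: "line_arrangement A \<Longrightarrow> T \<subseteq> A \<Longrightarrow> line_arrangement T"
  by (auto simp: line_arrangement_def intro: finite_subset)

text \<open>At a point of \<open>H\<close> the three values lie in the plane \<open>H\<close>, so
  their determinant vanishes.\<close>

lemma arr_poly_dvd_det3:
  assumes arr: "line_arrangement A"
    and "x \<in> derivation_module A" "y \<in> derivation_module A" "z \<in> derivation_module A"
  shows "arr_poly A dvd det3 x y z"
proof (rule arr_poly_dvd[OF arr])
  fix H v assume H: "H \<in> A" "v \<in> H"
  have line: "proj_line H" using arr H by (simp add: line_arrangement_def)
  have "ev_field x v \<in> H" "ev_field y v \<in> H" "ev_field z v \<in> H"
    using assms H by (auto simp: derivation_module_iff[OF arr])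
  then show "ev (det3 x y z) v = 0"
    using line normal_vec(1)[OF line] by (simp add: mem_proj_line det3_eq_0_if_common_kernel[of "normal_vec H"])
qed

lemma const_dvd_1: "c \<noteq> 0 \<Longrightarrow> const c dvd 1"
  by (rule dvdI[of _ _ "const (1 / c)"]) (rule S_eqI, simp)

lemma const_eq_0_iff [simp]: "const c = 0 \<longleftrightarrow> c = 0"
  by (simp add: const_def)

text \<open>The module contains Q times each coordinate field, so some three basis elements have
  nonzero determinant; a fourth would depend on them by Cramer's rule. Trilinearity then gives the
  divisibility.\<close>

lemma free_basis_triple:
  assumes arr: "line_arrangement A" and free: "free_arrangement A"
  obtains b1 b2 b3 where "b1 \<in> derivation_module A" "b2 \<in> derivation_module A"
    "b3 \<in> derivation_module A" "det3 b1 b2 b3 \<noteq> 0"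
    "\<And>x y z. x \<in> derivation_module A \<Longrightarrow> y \<in> derivation_module A \<Longrightarrow> z \<in> derivation_module A
      \<Longrightarrow> det3 b1 b2 b3 dvd det3 x y z"
proof -
  obtain B where indep: "DerS.independent B" and span: "DerS.span B = derivation_module A"
    using free by (auto simp: free_arrangement_def)
  have BD: "b \<in> derivation_module A" if "b \<in> B" for b
    using DerS.span_base[OF that] span by simp
  have "\<exists>b1\<in>B. \<exists>b2\<in>B. \<exists>b3\<in>B. det3 b1 b2 b3 \<noteq> 0"
  proof (rule ccontr)
    assume "\<not> ?thesis"
    \<comment> \<open>Divisibility by 0 expresses vanishing, so \<open>dvd_det3_span\<close> carries
      it from \<open>B\<close> to its span.\<close>
    then have 0: "0 dvd det3 x y z" if "x \<in> B" "y \<in> B" "z \<in> B" for x y z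
      using that by auto
    let ?e = "\<lambda>i. arr_poly A *s const_field (axis i 1)"
    have "?e i \<in> DerS.span B" for i
      unfolding span using arr ev_arr_poly_eq_0[OF arr] by (intro constant_field_mem) auto
    then have "0 dvd det3 (?e 1) (?e 2) (?e 3)" by (intro dvd_det3_span[OF 0])
    moreover have "det3 (const_field (axis 1 1)) (const_field (axis 2 1)) (const_field (axis 3 1)) = 1"
      by (rule S_eqI) (simp only: ev_det3 ev_field_const_field, simp add: det3_def axis_def)
    ultimately show False using arr_poly_ne_0[OF arr] by (simp add: det3_smult)
  qed
  then obtain b1 b2 b3 where b: "b1 \<in> B" "b2 \<in> B" "b3 \<in> B" "det3 b1 b2 b3 \<noteq> 0" by blast
  have ne: "b1 \<noteq> b2" "b1 \<noteq> b3" "b2 \<noteq> b3" using b(4) by auto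
  have B: "B = {b1, b2, b3}"
  proof (rule ccontr)
    assume "B \<noteq> {b1, b2, b3}"
    then obtain x where x: "x \<in> B" "x \<noteq> b1" "x \<noteq> b2" "x \<noteq> b3" using b by auto
    define u where "u = (\<lambda>_. 0)(x := det3 b1 b2 b3, b1 := - det3 x b2 b3, b2 := - det3 b1 x b3,
      b3 := - det3 b1 b2 x)"
    have "(\<Sum>v\<in>{x, b1, b2, b3}. u v *s v) = 0"
      using ne x cramer3[of b1 b2 b3 x] by (simp add: u_def)
    moreover have "u x \<noteq> 0" using x b by (simp add: u_def)
    ultimately have "DerS.dependent B"
      unfolding DerS.dependent_explicit using x b
      by (intro exI[of _ "{x, b1, b2, b3}"] exI[of _ u]) auto
    then show False using indep by simp
  qed
  have "det3 b1 b2 b3 dvd det3 x y z" if "x \<in> B" "y \<in> B" "z \<in> B" for x y z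
    using that unfolding B
    by (auto simp: det3_permute(1)[of b1 b3 b2] det3_permute(2)[of b2 b1 b3] det3_permute(3)[of b3 b2 b1]
      det3_permute(4)[of b2 b3 b1] det3_permute(5)[of b3 b1 b2])
  then have "det3 b1 b2 b3 dvd det3 x y z" if "x \<in> derivation_module A" "y \<in> derivation_module A"
    "z \<in> derivation_module A" for x y z
    using that dvd_det3_span[of B _ x y z] by (simp add: span)
  then show ?thesis using that[of b1 b2 b3] b BD by blast
qed

text \<open>The basis determinant is Q times \<open>g\<close> and divides every determinant of
  tangent fields. Let Q_H be the product of the forms other than that of \<open>H\<close>. The
  fields Q_H \<open>u\<close>, Q_H \<open>v\<close>, Q \<open>w\<close> with \<open>u\<close>,
  \<open>v\<close> spanning \<open>H\<close> show that \<open>g\<close> divides a constant times the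
  square of Q_H. So no line form divides \<open>g\<close>, and cancelling those in Q_H leaves a
  unit.\<close>

lemma saito:
  assumes arr: "line_arrangement A" and "A \<noteq> {}" and free: "free_arrangement A"
  obtains b1 b2 b3 c where "b1 \<in> derivation_module A" "b2 \<in> derivation_module A"
    "b3 \<in> derivation_module A" "c \<noteq> 0" "det3 b1 b2 b3 = const c * arr_poly A"
proof -
  obtain b1 b2 b3 where b: "b1 \<in> derivation_module A" "b2 \<in> derivation_module A"
    "b3 \<in> derivation_module A" "det3 b1 b2 b3 \<noteq> 0"
    and dvd: "\<And>x y z. x \<in> derivation_module A \<Longrightarrow> y \<in> derivation_module A \<Longrightarrow> z \<in> derivation_module A
      \<Longrightarrow> det3 b1 b2 b3 dvd det3 x y z"
    using free_basis_triple[OF arr free] by metis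
  have fin: "finite A" using arr by (simp add: line_arrangement_def)
  have Q0: "arr_poly A \<noteq> 0" by (rule arr_poly_ne_0[OF arr])
  obtain g where g: "det3 b1 b2 b3 = arr_poly A * g"
    using arr_poly_dvd_det3[OF arr b(1-3)] by (auto elim: dvdE)
  have key: "\<exists>c. c \<noteq> 0 \<and> g dvd const c * arr_poly (A - {H}) * arr_poly (A - {H})" if H: "H \<in> A" for H
  proof -
    have line: "proj_line H" using arr H by (simp add: line_arrangement_def)
    have arrH: "line_arrangement (A - {H})" using arr by (rule line_arrangement_subset) auto
    obtain u v where uv: "u \<in> H" "v \<in> H" "cross u v \<noteq> 0" using proj_line_basis[OF line] by metis
    then obtain i where i: "cross u v $ i \<noteq> 0" by (auto simp: vec_eq_iff)
    \<comment> \<open>A coordinate vector at a nonzero coordinate of \<open>cross u v\<close> is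
      independent of \<open>u\<close> and \<open>v\<close>.\<close>
    define w :: "complex^3" where "w = axis i 1"
    define c where "c = det3 u v w"
    have "c \<noteq> 0" using i by (simp add: c_def w_def det3_eq_dot3_cross)
    have "arr_poly (A - {H}) *s const_field x \<in> derivation_module A" if "x \<in> H" for x
      using that ev_arr_poly_eq_0[OF arrH] by (intro constant_field_mem[OF arr]) auto
    moreover have "arr_poly A *s const_field w \<in> derivation_module A"
      using ev_arr_poly_eq_0[OF arr] by (intro constant_field_mem[OF arr]) auto
    ultimately have "det3 b1 b2 b3 dvd det3 (arr_poly (A - {H}) *s const_field u) (arr_poly (A - {H}) *s const_field v) (arr_poly A *s const_field w)"
      using uv by (intro dvd) auto
    moreover have "det3 (const_field u) (const_field v) (const_field w) = const c"
      by (rule S_eqI) (simp add: c_def)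
    ultimately have "arr_poly A * g dvd arr_poly A * (const c * arr_poly (A - {H}) * arr_poly (A - {H}))"
      by (simp add: g det3_smult mult_ac)
    then have "g dvd const c * arr_poly (A - {H}) * arr_poly (A - {H})" using Q0 by simp
    then show ?thesis using \<open>c \<noteq> 0\<close> by blast
  qed
  have nd: "\<not> line_form H dvd g" if H: "H \<in> A" for H
  proof
    assume "line_form H dvd g"
    obtain c where c: "c \<noteq> 0" "g dvd const c * arr_poly (A - {H}) * arr_poly (A - {H})" using key[OF H] by blast
    have line: "proj_line H" using arr H by (simp add: line_arrangement_def)
    have arrH: "line_arrangement (A - {H})" using arr by (rule line_arrangement_subset) auto
    have "line_form H dvd const c * arr_poly (A - {H}) * arr_poly (A - {H})"
      using \<open>line_form H dvd g\<close> c(2) by (rule dvd_trans)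
    then have "line_form H dvd const c"
      using line_form_not_dvd_arr_poly[OF arrH line] prime_line_form[OF line] by (simp add: prime_elem_dvd_mult_iff)
    then have "line_form H dvd 1" using const_dvd_1[OF c(1)] by (rule dvd_trans)
    then show False using prime_line_form[OF line] by (simp add: prime_elem_not_unit)
  qed
  obtain H where H: "H \<in> A" using assms(2) by blast
  then obtain c where c: "c \<noteq> 0" "g dvd const c * arr_poly (A - {H}) * arr_poly (A - {H})" using key by blast
  have prm: "prime_elem (line_form K)" if "K \<in> A" for K
    using that arr by (intro prime_line_form) (simp add: line_arrangement_def)
  have cancel: "g dvd u" if "g dvd u * arr_poly (A - {H})" for u
    using that unfolding arr_poly_def by (rule dvd_cancel_primes[rotated 3]) (use fin prm nd in auto)
  have "g dvd const c" using c(2) by (blast intro: cancel)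
  then have "g dvd 1" using const_dvd_1[OF c(1)] by (rule dvd_trans)
  then obtain c' where "c' \<noteq> 0" "g = const c'" using unit_is_const by blast
  then show ?thesis using that[OF b(1-3)] g by (simp add: mult.commute)
qed

text \<open>The cofactor of Q is homogeneous of degree \<open>a + b + c - card A\<close>, which the
  degree bound makes 0.\<close>

lemma homogeneous_det3_eq_const_mult:
  assumes arr: "line_arrangement A"
    and D: "x \<in> derivation_module A" "y \<in> derivation_module A" "z \<in> derivation_module A"
    and "homogeneous_field a x" "homogeneous_field b y" "homogeneous_field c z" and "det3 x y z \<noteq> 0" "a + b + c \<le> card A"
  shows "a + b + c = card A \<and> (\<exists>k. k \<noteq> 0 \<and> det3 x y z = const k * arr_poly A)"
proof -
  obtain g where g: "det3 x y z = arr_poly A * g" using arr_poly_dvd_det3[OF arr D] by (auto elim: dvdE)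
  have "homogeneous (a + b + c) (arr_poly A * g)" using homogeneous_det3[OF assms(5-7)] g by simp
  moreover have "homogeneous (card A) (arr_poly A)" using arr by (intro homogeneous_arr_poly) (simp add: line_arrangement_def)
  moreover have "g \<noteq> 0" using assms(8) g by auto
  ultimately have q: "card A \<le> a + b + c \<and> homogeneous (a + b + c - card A) g"
    using homogeneous_quotient[OF arr_poly_ne_0[OF arr]] by blast
  then have "homogeneous 0 g" using assms(9) by simp
  then have "g = const (ev g 0)" by (rule homogeneous_0_const)
  then show ?thesis using q assms(9) g \<open>g \<noteq> 0\<close> by (metis const_eq_0_iff le_antisym mult.commute)
qed

text \<open>The Saito determinant, of degree \<open>card A\<close>, is expanded over homogeneous
  components: some triple of components with this total degree has nonzero determinant, and
  components stay in the module.\<close>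

lemma homogeneous_saito:
  assumes arr: "line_arrangement A" and "A \<noteq> {}" and free: "free_arrangement A"
  obtains x y z a b c where "x \<in> derivation_module A" "y \<in> derivation_module A"
    "z \<in> derivation_module A" "homogeneous_field a x" "homogeneous_field b y" "homogeneous_field c z"
    "a + b + c = card A" "det3 x y z \<noteq> 0"
proof -
  obtain b1 b2 b3 c where b: "b1 \<in> derivation_module A" "b2 \<in> derivation_module A"
    "b3 \<in> derivation_module A" "c \<noteq> 0" "det3 b1 b2 b3 = const c * arr_poly A"
    using saito[OF assms] by metis
  obtain c1 N1 where c1: "\<And>k. homogeneous_field k (c1 k)" "b1 = (\<Sum>k\<le>N1. c1 k)" using homogeneous_field_decomp by metis
  obtain c2 N2 where c2: "\<And>k. homogeneous_field k (c2 k)" "b2 = (\<Sum>k\<le>N2. c2 k)" using homogeneous_field_decomp by metis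
  obtain c3 N3 where c3: "\<And>k. homogeneous_field k (c3 k)" "b3 = (\<Sum>k\<le>N3. c3 k)" using homogeneous_field_decomp by metis
  define T where "T = {..N1} \<times> {..N2} \<times> {..N3}"
  define F where "F n = (\<Sum>(i, j, k)\<in>{t\<in>T. (\<lambda>(i, j, k). i + j + k) t = n}. det3 (c1 i) (c2 j) (c3 k))" for n
  have "det3 b1 b2 b3 = (\<Sum>(i, j, k)\<in>T. det3 (c1 i) (c2 j) (c3 k))"
    unfolding c1(2) c2(2) c3(2) T_def
    by (simp only: det3_sum(1), simp only: det3_sum(2), simp only: det3_sum(3) sum.cartesian_product)
  also have "\<dots> = (\<Sum>n\<le>N1 + N2 + N3. F n)"
    unfolding F_def by (rule sum.group[symmetric]) (auto simp: T_def)
  finally have sumF: "det3 b1 b2 b3 = (\<Sum>n\<le>N1 + N2 + N3. F n)" .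
  have homF: "homogeneous n (F n)" for n
    unfolding homogeneous_def F_def
    by (auto simp: sum_distrib_left homogeneous_field_ev[OF c1(1)] homogeneous_field_ev[OF c2(1)] homogeneous_field_ev[OF c3(1)]
      det3_smult power_add mult_ac case_prod_unfold intro!: sum.cong)
  have homD: "homogeneous (card A) (\<Sum>n\<le>N1 + N2 + N3. F n)"
    using homogeneous_mult[OF homogeneous_const homogeneous_arr_poly[of A], of c] arr b(5) sumF by (simp add: line_arrangement_def)
  have "F (card A) \<noteq> 0"
  proof
    assume "F (card A) = 0"
    then have "F n = 0" if "n \<le> N1 + N2 + N3" for n
      using homogeneous_sum_unique[OF homF homD that] by (cases "n = card A") auto
    then have "det3 b1 b2 b3 = 0" unfolding sumF by simp
    then show False using b arr_poly_ne_0[OF arr] by simp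
  qed
  then obtain i j k where ijk: "(i, j, k) \<in> T" "i + j + k = card A" "det3 (c1 i) (c2 j) (c3 k) \<noteq> 0"
    unfolding F_def by (auto elim!: sum.not_neutral_contains_not_neutral)
  show ?thesis
  proof (rule that[OF _ _ _ c1(1) c2(1) c3(1) ijk(2,3)])
    show "c1 i \<in> derivation_module A"
      using b(1) ijk(1) by (intro derivation_module_components[OF arr c1(1)]) (auto simp: c1(2) T_def)
    show "c2 j \<in> derivation_module A"
      using b(2) ijk(1) by (intro derivation_module_components[OF arr c2(1)]) (auto simp: c2(2) T_def)
    show "c3 k \<in> derivation_module A"
      using b(3) ijk(1) by (intro derivation_module_components[OF arr c3(1)]) (auto simp: c3(2) T_def)
  qed
qed

text \<open>A constant field tangent to every line is a vector lying on all of them; if nonzero, it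
  spans the centre of a pencil.\<close>

lemma homogeneous_field_0_imp_0:
  assumes arr: "line_arrangement A" and "\<not> pencil A" "\<theta> \<in> derivation_module A" "homogeneous_field 0 \<theta>"
  shows "\<theta> = 0"
proof -
  define w where "w = ev_field \<theta> 0"
  \<comment> \<open>Scaling by 0 with \<open>0 ^ 0 = 1\<close> equates every value with the one at
    the origin.\<close>
  have ev: "ev_field \<theta> v = w" for v using homogeneous_field_ev[OF assms(4), of 0 v] by (simp add: w_def)
  have wH: "w \<in> H" "vec.subspace H" if "H \<in> A" for H
  proof -
    show "vec.subspace H" using that arr by (simp add: line_arrangement_def proj_line_def)
    then have "0 \<in> H" by (rule vec.subspace_0)
    then show "w \<in> H" using that assms(3) ev by (auto simp: derivation_module_iff[OF arr])
  qed
  have "w = 0"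
  proof (rule ccontr)
    assume "w \<noteq> 0"
    then have "proj_point (range (\<lambda>c. c *s w))" by (rule proj_point_range)
    moreover have "range (\<lambda>c. c *s w) \<subseteq> H" if "H \<in> A" for H
      using wH[OF that] by (simp add: range_smult_subset_iff)
    ultimately show False using assms(2) unfolding pencil_def by metis
  qed
  then show ?thesis using ev by (intro ev_field_eqI) simp
qed

text \<open>By Cramer's rule the Euler field can replace one of three homogeneous fields while the
  determinant stays nonzero. The replaced degree is positive, so the total degree does not grow, and
  \<open>homogeneous_det3_eq_const_mult\<close> applies.\<close>

lemma euler_basis:
  assumes arr: "line_arrangement A" and np: "\<not> pencil A" and "A \<noteq> {}" and free: "free_arrangement A"
  obtains x y a b k where "x \<in> derivation_module A" "y \<in> derivation_module A"
    "homogeneous_field a x" "homogeneous_field b y" "1 + a + b = card A" "k \<noteq> 0" "det3 euler x y = const k * arr_poly A" "a \<le> b"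
proof -
  obtain x y z a b c where D: "x \<in> derivation_module A" "y \<in> derivation_module A"
    "z \<in> derivation_module A" and h: "homogeneous_field a x" "homogeneous_field b y" "homogeneous_field c z"
    and deg: "a + b + c = card A" and ne: "det3 x y z \<noteq> 0"
    using homogeneous_saito[OF arr assms(3) free] by metis
  have pos: "a \<noteq> 0" "b \<noteq> 0" "c \<noteq> 0"
    using homogeneous_field_0_imp_0[OF arr np D(1)] homogeneous_field_0_imp_0[OF arr np D(2)] homogeneous_field_0_imp_0[OF arr np D(3)] h ne
    by (metis det3_zero)+
  note result = that
  have fin: thesis if xy: "x \<in> derivation_module A" "y \<in> derivation_module A"
    "homogeneous_field a x" "homogeneous_field b y" "1 + a + b \<le> card A" "det3 euler x y \<noteq> 0" for x y a b
  proof -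
    obtain k where k: "1 + a + b = card A" "k \<noteq> 0" "det3 euler x y = const k * arr_poly A"
      using homogeneous_det3_eq_const_mult[OF arr euler_mem[OF arr] xy(1,2) homogeneous_field_euler xy(3,4,6,5)] by blast
    show thesis
    proof (cases "a \<le> b")
      case True
      then show ?thesis using result xy k by blast
    next
      case False
      have "const (- k) = - const k" by (rule S_eqI) simp
      then have "det3 euler y x = const (- k) * arr_poly A"
        using k(3) det3_permute(1)[of euler y x] by simp
      then show ?thesis using k False by (intro result[OF xy(2,1,4,3), of "- k"]) auto
    qed
  qed
  have "euler \<noteq> 0"
    using ev_field_euler[of "axis 1 1"] by (metis axis_eq_0_iff ev_field_0 zero_neq_one)
  then have "det3 x y z *s euler \<noteq> 0" using ne by (auto simp: vec_eq_iff)
  then consider "det3 euler y z \<noteq> 0" | "det3 x euler z \<noteq> 0" | "det3 x y euler \<noteq> 0"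
    unfolding cramer3[of x y z euler] by fastforce
  then show thesis
  proof cases
    case 1
    then show ?thesis using fin[of y z b c] D h deg pos by simp
  next
    case 2
    then have "det3 euler x z \<noteq> 0" using det3_permute(2)[of x euler z] by simp
    then show ?thesis using fin[of x z a c] D h deg pos by simp
  next
    case 3
    then have "det3 euler x y \<noteq> 0" using det3_permute(5)[of euler x y] by simp
    then show ?thesis using fin[of x y a b] D h deg pos by simp
  qed
qed

section \<open>Free arrangements with a point of large multiplicity\<close>

text \<open>Vanishing of \<theta> \<and> E along \<open>L\<close>, written by 2-by-2 minors so that
  no factor of proportionality is named.\<close>

definition radial_on :: "(complex^3) set \<Rightarrow> S^3 \<Rightarrow> bool" where
  "radial_on L \<theta> \<longleftrightarrow> (\<forall>v\<in>L. \<forall>i j. ev (\<theta>$i) v * v$j = ev (\<theta>$j) v * v$i)"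

lemma smult_cancel_left:
  fixes x y :: "'a::idom^'n"
  shows "a *s x = a *s y \<Longrightarrow> a \<noteq> 0 \<Longrightarrow> x = y"
  by (simp only: vec_eq_iff vector_smult_component mult_cancel_left) simp

lemma ev_euler_nth [simp]: "ev (euler$i) v = v$i"
  using ev_field_nth[of euler v i] by simp

text \<open>At a point of \<open>P\<close> the field is tangent to two lines, hence to their common
  point, so each minor of \<open>\<theta>\<close> and the Euler field vanishes there. A minor has
  degree \<open>e + 1\<close>, and on \<open>L\<close> it is a binary form with at least
  \<open>e + 2\<close> zeros.\<close>

lemma low_degree_radial:
  assumes arr: "line_arrangement A" and \<theta>: "\<theta> \<in> derivation_module A" "homogeneous_field e \<theta>" and L: "L \<in> A"
    and P: "finite P" "e + 2 \<le> card P"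
    and Ppt: "\<And>q. q \<in> P \<Longrightarrow> proj_point q" and PL: "\<And>q. q \<in> P \<Longrightarrow> q \<subseteq> L"
    and PH: "\<And>q. q \<in> P \<Longrightarrow> \<exists>H\<in>A. H \<noteq> L \<and> q \<subseteq> H"
  shows "radial_on L \<theta>"
  unfolding radial_on_def
proof (intro ballI allI)
  fix v i j assume v: "v \<in> L"
  define f where "f = \<theta>$i * euler$j - \<theta>$j * euler$i"
  have homf: "homogeneous (e + 1) f"
    unfolding f_def using \<theta>(2) homogeneous_field_euler by (intro homogeneous_diff homogeneous_mult) (auto simp: homogeneous_field_def)
  have line: "proj_line H" if "H \<in> A" for H using that arr by (simp add: line_arrangement_def)
  have fq: "ev f x = 0" if q: "q \<in> P" and x: "x \<in> q" for q x
  proof -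
    obtain H where H: "H \<in> A" "H \<noteq> L" "q \<subseteq> H" using PH[OF q] by blast
    have "q = H \<inter> L" using H q L line Ppt PL by (intro proj_point_eq_Int) auto
    moreover have "x \<in> H" "x \<in> L" using H(3) PL[OF q] x by auto
    then have "ev_field \<theta> x \<in> H \<inter> L"
      using \<theta>(1) H(1) L by (simp add: derivation_module_iff[OF arr])
    ultimately have "ev_field \<theta> x \<in> q" by simp
    moreover obtain w where "q = range (\<lambda>c. c *s w)" using proj_point_obtain[OF Ppt[OF q]] by metis
    ultimately obtain c c' where "x = c *s w" "ev_field \<theta> x = c' *s w" using x by auto
    then have "x$i = c * w$i" "x$j = c * w$j" "ev (\<theta>$i) x = c' * w$i" "ev (\<theta>$j) x = c' * w$j"
      by (simp_all add: vec_eq_iff)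
    then show ?thesis by (simp add: f_def)
  qed
  \<comment> \<open>One point, \<open>q0\<close>, becomes the point at infinity \<open>u\<close> of
    \<open>L\<close>; every other point \<open>q\<close> gets an affine coordinate
    \<open>r q\<close>, represented by \<open>w + r q *s u\<close>.\<close>
  obtain q0 where q0: "q0 \<in> P" using P by fastforce
  obtain u where u: "u \<noteq> 0" "q0 = range (\<lambda>c. c *s u)" using proj_point_obtain[OF Ppt[OF q0]] by metis
  have "q0 \<noteq> L" using Ppt[OF q0] line[OF L] by (auto simp: proj_point_def proj_line_def)
  then obtain w where w: "w \<in> L" "w \<notin> q0" using PL[OF q0] by blast
  have "0 *s u \<in> q0" unfolding u(2) by blast
  then have "w \<noteq> 0" using w by auto
  define q1 where "q1 = range (\<lambda>c. c *s w)"
  have q1: "proj_point q1" "q1 \<subseteq> L" "w \<in> q1"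
    using proj_point_range[OF \<open>w \<noteq> 0\<close>] range_smult_subset_iff[of L w] line[OF L] w
      range_eqI[of w "\<lambda>c. c *s w" 1]
    by (auto simp: q1_def proj_line_def)
  have "L = vec.span (q0 \<union> q1)"
    using q0 q1 Ppt PL L line w by (intro proj_line_eq_span) auto
  also have "\<dots> = {x + y |x y. x \<in> q0 \<and> y \<in> q1}"
    using Ppt[OF q0] q1(1) by (simp add: proj_point_def vec.span_Un vec.span_eq_iff[THEN iffD2])
  finally have Lrep: "\<exists>a b. x = a *s u + b *s w" if "x \<in> L" for x
    using that by (auto simp: u(2) q1_def)
  have "\<exists>a. w + a *s u \<in> q" if q: "q \<in> P - {q0}" for q
  proof -
    obtain x where x: "x \<noteq> 0" "q = range (\<lambda>c. c *s x)" using q proj_point_obtain Ppt by (metis DiffD1)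
    have sub: "vec.subspace q" using q Ppt by (auto simp: proj_point_def)
    have xq: "x \<in> q" using range_smult_subset_iff[OF sub] x(2) by blast
    then obtain a b where ab: "x = a *s u + b *s w" using Lrep PL q by blast
    have "b \<noteq> 0"
    proof
      assume "b = 0"
      then have "x \<in> q0" using ab by (auto simp: u(2))
      then have "q \<subseteq> q0"
        using Ppt[OF q0] unfolding x(2) by (subst range_smult_subset_iff) (auto simp: proj_point_def)
      then show False using q proj_point_subset_eq Ppt q0 by blast
    qed
    then have "w + (a / b) *s u = (1 / b) *s x" by (simp add: ab vec_eq_iff field_simps)
    then have "w + (a / b) *s u \<in> q" using xq sub by (simp add: vec.subspace_scale)
    then show ?thesis by blast
  qed
  then obtain r where r: "\<And>q. q \<in> P - {q0} \<Longrightarrow> w + r q *s u \<in> q" by metis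
  have ne: "w + a *s u \<noteq> 0" for a
  proof
    assume "w + a *s u = 0"
    then have "w = (- a) *s u" by (simp add: vec_eq_iff eq_neg_iff_add_eq_0)
    then show False using w(2) u(2) by blast
  qed
  have "inj_on r (P - {q0})"
  proof (rule inj_onI)
    fix q q' assume q: "q \<in> P - {q0}" "q' \<in> P - {q0}" "r q = r q'"
    let ?x = "w + r q *s u"
    have x: "?x \<in> q" "?x \<in> q'" using r[OF q(1)] r[OF q(2)] q(3) by auto
    have pt: "proj_point (range (\<lambda>c. c *s ?x))" by (rule proj_point_range[OF ne])
    have eq: "range (\<lambda>c. c *s ?x) = q''" if "q'' \<in> P" "?x \<in> q''" for q''
    proof (rule proj_point_subset_eq[OF pt Ppt[OF that(1)]])
      have "vec.subspace q''" using Ppt[OF that(1)] by (simp add: proj_point_def)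
      then show "range (\<lambda>c. c *s ?x) \<subseteq> q''" using that(2) by (simp only: range_smult_subset_iff)
    qed
    show "q = q'" using eq[of q] eq[of q'] q x by blast
  qed
  then have card: "e + 1 \<le> card (r ` (P - {q0}))"
    using P q0 by (simp add: card_image)
  have "u \<in> q0" using range_eqI[of u "\<lambda>c. c *s u" 1] by (simp add: u(2))
  then have "ev f u = 0" using fq q0 by blast
  obtain a b where ab: "v = a *s u + b *s w" using Lrep[OF v] by blast
  have "ev f (a *s u + b *s w) = 0"
  proof (rule binary_form_eq_0[OF homf \<open>ev f u = 0\<close> _ card])
    show "ev f (w + t *s u) = 0" if "t \<in> r ` (P - {q0})" for t
      using that r fq by blast
  qed (use P in auto)
  then show "ev (\<theta>$i) v * v$j = ev (\<theta>$j) v * v$i"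
    unfolding ab[symmetric] by (simp add: f_def)
qed

text \<open>Otherwise all coordinates would vanish on \<open>L\<close>. The coordinate found can be
  cancelled modulo the prime \<open>line_form L\<close>.\<close>

lemma ex_euler_not_dvd:
  assumes "proj_line L"
  shows "\<exists>i. \<not> line_form L dvd euler$i"
proof (rule ccontr)
  assume "\<not> ?thesis"
  then have "v$i = 0" if "v \<in> L" for v i using that assms by (simp add: line_form_dvd_iff)
  then have "L \<subseteq> {0}" by (auto simp: vec_eq_iff)
  then have "vec.dim L = 0" by (simp only: vec.dim_eq_0)
  then show False using assms unfolding proj_line_def by linarith
qed

lemma dvd_vecE:
  fixes x :: "'a::comm_ring_1^3"
  assumes "\<And>j. a dvd x$j"
  obtains \<psi> where "x = a *s \<psi>"
proof -
  have "\<forall>j. \<exists>y. x$j = a * y" using assms by (auto simp: dvd_def)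
  then obtain y where "\<And>j. x$j = a * y j" by metis
  then have "x = a *s (\<chi> j. y j)" by (simp add: vec_eq_iff)
  then show ?thesis by (rule that)
qed

text \<open>After multiplication by a coordinate not divisible by \<open>line_form L\<close>, both
  fields are multiples of the Euler field modulo this form. So its square divides the determinant
  times the squared coordinate, whereas Q contains it only once.\<close>

lemma not_both_radial:
  assumes arr: "line_arrangement A" and L: "L \<in> A" and k: "k \<noteq> 0"
    and det: "det3 euler \<theta> \<eta> = const k * arr_poly A" and radial_on: "radial_on L \<theta>" "radial_on L \<eta>"
  shows False
proof -
  have line: "proj_line L" and fin: "finite A" using arr L by (auto simp: line_arrangement_def)
  obtain i where i: "\<not> line_form L dvd euler$i" using ex_euler_not_dvd[OF line] by blast
  have ex: "\<exists>\<psi>. euler$i *s \<theta> = \<theta>$i *s euler + line_form L *s \<psi>" if "radial_on L \<theta>" for \<theta>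
  proof -
    have "line_form L dvd (euler$i *s \<theta> - \<theta>$i *s euler)$j" for j
      using that line by (auto simp: line_form_dvd_iff radial_on_def mult.commute)
    then obtain \<psi> where "euler$i *s \<theta> - \<theta>$i *s euler = line_form L *s \<psi>" by (rule dvd_vecE)
    then show ?thesis by (metis add.commute diff_add_cancel)
  qed
  obtain \<psi> where \<psi>: "euler$i *s \<theta> = \<theta>$i *s euler + line_form L *s \<psi>" using ex[OF radial_on(1)] by blast
  obtain \<phi> where \<phi>: "euler$i *s \<eta> = \<eta>$i *s euler + line_form L *s \<phi>" using ex[OF radial_on(2)] by blast
  let ?Q = "arr_poly (A - {L})"
  have "euler$i * euler$i * det3 euler \<theta> \<eta> = det3 euler (euler$i *s \<theta>) (euler$i *s \<eta>)"
    by (simp add: det3_smult mult_ac)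
  also have "\<dots> = line_form L * (line_form L * det3 euler \<psi> \<phi>)"
    unfolding \<psi> \<phi> by (simp add: det3_add det3_smult)
  finally have "line_form L * (euler$i * (euler$i * (const k * ?Q))) = line_form L * (line_form L * det3 euler \<psi> \<phi>)"
    unfolding det arr_poly_remove[OF fin L] by (simp add: mult_ac)
  then have "euler$i * (euler$i * (const k * ?Q)) = line_form L * det3 euler \<psi> \<phi>"
    using prime_elem_not_zeroI[OF prime_line_form[OF line]] by simp
  then have "line_form L dvd euler$i * (euler$i * (const k * ?Q))" by simp
  then have "line_form L dvd const k \<or> line_form L dvd ?Q"
    using i prime_line_form[OF line] by (simp add: prime_elem_dvd_mult_iff)
  moreover have "\<not> line_form L dvd ?Q"
    by (rule line_form_not_dvd_arr_poly[OF line_arrangement_subset[OF arr] line]) auto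
  moreover have "\<not> line_form L dvd const k"
    using dvd_trans[OF _ const_dvd_1[OF k]] prime_line_form[OF line] prime_elem_not_unit by blast
  ultimately show False by blast
qed

text \<open>A form of a line off \<open>w\<close> dividing \<open>f\<close> would also divide \<open>g\<close>, and cancelling it would yield a
  tangent field that is not tangent to that line. So \<open>f\<close> is prime to \<open>Q'\<close>, and wedging the equation with
  \<open>E\<close> shows that \<open>f\<close> divides two independent linear forms.\<close>

lemma pencil_field_coeff_unit:
  assumes arr: "line_arrangement A" and x: "x \<in> derivation_module A" and w: "w \<notin> L" "L \<in> A"
    and R: "R = {H \<in> A. w \<notin> H}" and eq: "arr_poly R *s const_field w = g *s euler + f *s x"
  shows "f dvd 1"
proof -
  have line: "proj_line H" if "H \<in> A" for H using that arr by (simp add: line_arrangement_def)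
  have arrR: "line_arrangement R" using arr by (rule line_arrangement_subset) (auto simp: R)
  then have finR: "finite R" by (simp add: line_arrangement_def)
  have nd: "\<not> line_form H dvd f" if H: "H \<in> R" for H
  proof
    assume "line_form H dvd f"
    then obtain f' where f': "f = line_form H * f'" by (auto elim: dvdE)
    have lH: "proj_line H" and "H \<in> A" and wH: "w \<notin> H" using H line by (auto simp: R)
    obtain i where i: "\<not> line_form H dvd euler$i" using ex_euler_not_dvd[OF lH] by blast
    have QR: "arr_poly R = line_form H * arr_poly (R - {H})" by (rule arr_poly_remove[OF finR H])
    have "line_form H * (arr_poly (R - {H}) * const_field w $ i) = g * euler$i + line_form H * (f' * x$i)"
      using arg_cong[OF eq, of "\<lambda>y. y$i"] by (simp add: QR f' mult_ac)
    then have "g * euler$i = line_form H * (arr_poly (R - {H}) * const_field w $ i - f' * x$i)"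
      by (simp add: algebra_simps)
    then have "line_form H dvd g * euler$i" by simp
    then have "line_form H dvd g" using i prime_line_form[OF lH] by (simp add: prime_elem_dvd_mult_iff)
    then obtain g' where g': "g = line_form H * g'" by (auto elim: dvdE)
    have "line_form H *s (arr_poly (R - {H}) *s const_field w) = line_form H *s (g' *s euler + f' *s x)"
      using eq by (simp add: QR f' g' vec_eq_iff algebra_simps)
    then have "arr_poly (R - {H}) *s const_field w = g' *s euler + f' *s x"
      by (rule smult_cancel_left) (rule prime_elem_not_zeroI[OF prime_line_form[OF lH]])
    also have "\<dots> \<in> derivation_module A"
      using subspace_derivation_module x euler_mem[OF arr]
      by (intro DerS.subspace_add DerS.subspace_scale)
    finally have mem: "arr_poly (R - {H}) *s const_field w \<in> derivation_module A" .
    \<comment> \<open>\<open>w\<close> is off \<open>H\<close>, so a multiple of \<open>w\<close>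
      tangent to \<open>H\<close> must be zero there.\<close>
    have "ev (arr_poly (R - {H})) v = 0" if "v \<in> H" for v
    proof (rule ccontr)
      let ?c = "ev (arr_poly (R - {H})) v"
      assume "?c \<noteq> 0"
      have "?c *s w \<in> H" using mem that \<open>H \<in> A\<close> by (auto simp: derivation_module_iff[OF arr])
      then have "inverse ?c *s (?c *s w) \<in> H"
        by (rule vec.subspace_scale[OF proj_line_subspace[OF lH]])
      then show False using wH \<open>?c \<noteq> 0\<close> by (simp only: vector_smult_assoc) simp
    qed
    then have "line_form H dvd arr_poly (R - {H})" using lH by (simp add: line_form_dvd_iff)
    moreover have "\<not> line_form H dvd arr_poly (R - {H})"
      by (rule line_form_not_dvd_arr_poly[OF line_arrangement_subset[OF arrR] lH]) auto
    ultimately show False by blast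
  qed
  have dvd: "f dvd linear_form (cross w z)" for z
  proof -
    \<comment> \<open>Taking the determinant with the Euler field and the constant field
      \<open>z\<close> removes the term with \<open>g\<close>.\<close>
    have "linear_form (cross w z) * arr_poly R = f * det3 euler x (const_field z)"
    proof -
      have "det3 euler (arr_poly R *s const_field w) (const_field z) = f * det3 euler x (const_field z)"
        unfolding eq by (simp add: det3_add det3_smult)
      moreover have "linear_form (cross w z) = det3 euler (const_field w) (const_field z)"
        by (rule S_eqI) (simp add: det3_eq_dot3_cross[symmetric] det3_permute(4)[of w z])
      ultimately show ?thesis by (simp add: det3_smult mult.commute)
    qed
    then have "f dvd linear_form (cross w z) * prod line_form R" by (simp add: arr_poly_def)
    then show ?thesis
      by (rule dvd_cancel_primes[rotated 3]) (use finR nd line prime_line_form in \<open>auto simp: R\<close>)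
  qed
  \<comment> \<open>With \<open>w\<close> off \<open>L\<close> and \<open>u\<close>,
    \<open>v\<close> spanning \<open>L\<close>, the forms of \<open>cross w u\<close> and
    \<open>cross w v\<close> are independent, and \<open>f\<close> divides both.\<close>
  obtain u v where uv: "cross u v \<noteq> 0" "L = ker3 (cross u v)" using proj_line_ker3[OF line[OF w(2)]] by metis
  have d: "det3 u v w \<noteq> 0" using w(1) uv by (simp add: det3_eq_dot3_cross mem_ker3)
  have dot: "dot3 (cross w v) u \<noteq> 0" "dot3 (cross w u) v \<noteq> 0" "dot3 (cross w u) u = 0"
    using d det3_permute(3)[of w v u] det3_permute(5)[of w u v]
    by (simp_all add: det3_eq_dot3_cross[symmetric])
  have "cross w u \<noteq> 0" using dot(2) by (auto simp: dot3_def)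
  then have prime: "prime_elem (linear_form (cross w u))" by (rule prime_linear_form)
  have "\<not> linear_form (cross w u) dvd f"
  proof
    assume "linear_form (cross w u) dvd f"
    then have "linear_form (cross w u) dvd linear_form (cross w v)" using dvd by (rule dvd_trans)
    then show False
      using linear_form_dvd_iff[OF \<open>cross w u \<noteq> 0\<close>] dot by (auto simp: mem_ker3)
  qed
  \<comment> \<open>\<open>f\<close> divides the prime form of \<open>cross w u\<close> but is not
    divisible by it; cancelling this single prime leaves a divisor of 1.\<close>
  then show "f dvd 1"
    using dvd_cancel_primes[of "{()}" "\<lambda>_. linear_form (cross w u)" f 1] prime dvd by simp
qed

lemma free_imp_modular:
  assumes arr: "line_arrangement A" and np: "\<not> pencil A" and free: "free_arrangement A"
    and p: "p \<in> intersection_points A" and m: "card A \<le> 2 * point_mult A p"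
  shows "modular_point A p"
proof (rule ccontr)
  assume "\<not> modular_point A p"
  then obtain q where q: "q \<in> intersection_points A" "q \<noteq> p" "vec.span (p \<union> q) \<notin> A"
    using p by (auto simp: modular_point_def)
  have line: "proj_line H" if "H \<in> A" for H using that arr by (simp add: line_arrangement_def)
  have fin: "finite A" using arr by (simp add: line_arrangement_def)
  have pts: "proj_point p" "proj_point q" using p q by (auto simp: intersection_points_def)
  have nopq: "\<not> q \<subseteq> H" if "H \<in> A" "p \<subseteq> H" for H
    using that proj_line_eq_span[OF pts _ line] q by metis
  obtain L K where L: "L \<in> A" "K \<in> A" "L \<noteq> K" "q \<subseteq> L" "q \<subseteq> K"
    using intersection_pointE[OF q(1)] by metis
  have pL: "\<not> p \<subseteq> L" using nopq L by blast
  define m where "m = point_mult A p"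
  define Ap where "Ap = {H \<in> A. p \<subseteq> H}"
  \<comment> \<open>The \<open>m\<close> lines through \<open>p\<close> give \<open>m\<close> points
    of \<open>L\<close>, and \<open>q\<close> is one more, since no line of the arrangement joins it
    to \<open>p\<close>.\<close>
  define P where "P = insert q ((\<lambda>H. H \<inter> L) ` Ap)"
  have finAp: "finite Ap" using fin by (simp add: Ap_def)
  have "q \<notin> (\<lambda>H. H \<inter> L) ` Ap" using nopq by (auto simp: Ap_def)
  then have cardP: "card P = m + 1"
    using finAp inj_on_Int_pencil[OF arr pts(1) L(1) pL]
    by (simp add: P_def m_def point_mult_def card_image Ap_def)
  have low: "radial_on L \<theta>" if "\<theta> \<in> derivation_module A" "homogeneous_field e \<theta>" "e + 1 \<le> m" for \<theta> e
  proof (rule low_degree_radial[OF arr that(1,2) L(1)])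
    show "finite P" using finAp by (simp add: P_def)
    show "e + 2 \<le> card P" using that(3) cardP by simp
    have *: "r = q \<or> (\<exists>H\<in>A. H \<noteq> L \<and> r = H \<inter> L)" if "r \<in> P" for r
      using that pL by (auto simp: P_def Ap_def)
    show "proj_point r" if "r \<in> P" for r
      using *[OF that] pts line L proj_point_Int by blast
    show "r \<subseteq> L" if "r \<in> P" for r using *[OF that] L by blast
    show "\<exists>H\<in>A. H \<noteq> L \<and> r \<subseteq> H" if "r \<in> P" for r using *[OF that] L by blast
  qed
  have "A \<noteq> {}" using L by auto
  then obtain x y a b k where x: "x \<in> derivation_module A" "homogeneous_field a x"
    and y: "y \<in> derivation_module A" "homogeneous_field b y"
    and ab: "1 + a + b = card A" "a \<le> b" and k: "k \<noteq> 0" "det3 euler x y = const k * arr_poly A"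
    using euler_basis[OF arr np _ free] by metis
  \<comment> \<open>From \<open>a \<le> b\<close> and
    \<open>1 + a + b = card A \<le> 2 * m\<close>.\<close>
  have am: "a + 1 \<le> m" using ab m by (simp add: m_def)
  have parx: "radial_on L x" by (rule low[OF x am])
  have bm: "m \<le> b"
  proof (rule ccontr)
    assume "\<not> m \<le> b"
    then have "radial_on L y" using y by (intro low) auto
    then show False using not_both_radial[OF arr L(1) k parx] by blast
  qed
  obtain w where w: "w \<noteq> 0" "p = range (\<lambda>c. c *s w)" using proj_point_obtain[OF pts(1)] by metis
  have pH: "p \<subseteq> H \<longleftrightarrow> w \<in> H" if "H \<in> A" for H
    unfolding w(2) by (rule range_smult_subset_iff[OF proj_line_subspace[OF line[OF that]]])
  have wL: "w \<notin> L" using pH L pL by blast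
  define R where "R = {H \<in> A. w \<notin> H}"
  have arrR: "line_arrangement R" using arr by (rule line_arrangement_subset) (auto simp: R_def)
  have finR: "finite R" using arrR by (simp add: line_arrangement_def)
  have "card A = card (Ap \<union> R)" by (rule arg_cong[of _ _ card]) (use pH in \<open>auto simp: Ap_def R_def\<close>)
  also have "\<dots> = card Ap + card R"
    using finAp finR pH by (intro card_Un_disjoint) (auto simp: Ap_def R_def)
  finally have cardR: "card A = m + card R" by (simp add: m_def point_mult_def Ap_def)
  define \<theta> where "\<theta> = arr_poly R *s const_field w"
  have \<theta>: "\<theta> \<in> derivation_module A"
    unfolding \<theta>_def using ev_arr_poly_eq_0[OF arrR] by (intro constant_field_mem[OF arr]) (auto simp: R_def)
  have homogeneous\<theta>: "homogeneous_field (card R) \<theta>"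
    using homogeneous_mult[OF homogeneous_arr_poly[OF finR] homogeneous_const] by (simp add: homogeneous_field_def \<theta>_def const_field_def)
  have "L \<in> R" using L wL by (simp add: R_def)
  then have radial_on\<theta>: "radial_on L \<theta>"
    using ev_arr_poly_eq_0[OF arrR] by (simp add: radial_on_def \<theta>_def)
  \<comment> \<open>The total degree \<open>1 + a + card R\<close> is at most
    \<open>m + card R = card A\<close>, so a nonzero determinant would be a constant times Q,
    although both fields are radial on \<open>L\<close>.\<close>
  have d0: "det3 euler x \<theta> = 0"
  proof (rule ccontr)
    assume "det3 euler x \<theta> \<noteq> 0"
    then obtain k' where "k' \<noteq> 0" "det3 euler x \<theta> = const k' * arr_poly A"
      using homogeneous_det3_eq_const_mult[OF arr euler_mem[OF arr] x(1) \<theta> homogeneous_field_euler x(2) homogeneous\<theta>] am cardR by auto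
    then show False using not_both_radial[OF arr L(1) _ _ parx radial_on\<theta>] by blast
  qed
  have Q0: "arr_poly A \<noteq> 0" by (rule arr_poly_ne_0[OF arr])
  obtain g1 where g1: "det3 \<theta> x y = arr_poly A * g1"
    using arr_poly_dvd_det3[OF arr \<theta> x(1) y(1)] by (auto elim: dvdE)
  obtain f1 where f1: "det3 euler \<theta> y = arr_poly A * f1"
    using arr_poly_dvd_det3[OF arr euler_mem[OF arr] \<theta> y(1)] by (auto elim: dvdE)
  \<comment> \<open>In Cramer's relation the coefficient of \<open>y\<close> vanishes by
    \<open>d0\<close> and Q cancels, which leaves only the constant \<open>k\<close> to divide
    out.\<close>
  define g f where "g = const (1 / k) * g1" and "f = const (1 / k) * f1"
  have kk: "const (1 / k) * const k = 1" using k(1) by (intro S_eqI) simp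
  have "arr_poly A *s (const k *s \<theta>) = arr_poly A *s (g1 *s euler + f1 *s x)"
    using cramer3[of euler x y \<theta>] unfolding d0 g1 f1 k(2) by (simp add: vec_eq_iff algebra_simps)
  then have "const k *s \<theta> = g1 *s euler + f1 *s x" using Q0 by (rule smult_cancel_left)
  then have "const (1 / k) *s (const k *s \<theta>) = const (1 / k) *s (g1 *s euler + f1 *s x)" by simp
  then have eq: "\<theta> = g *s euler + f *s x"
    using kk by (simp add: vector_smult_assoc g_def f_def vector_add_ldistrib)
  have "f dvd 1" by (rule pencil_field_coeff_unit[OF arr x(1) wL L(1) R_def eq[unfolded \<theta>_def]])
  then obtain c where c: "c \<noteq> 0" "f = const c" using unit_is_const by blast
  \<comment> \<open>Degree comparison: the determinant has degree
    \<open>card A + (b - m) + 1\<close>, so its cofactor over Q has positive degree, yet this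
    cofactor is a nonzero constant.\<close>
  have "det3 euler \<theta> y = arr_poly A * (const k * f)"
    unfolding eq by (simp add: det3_add det3_smult k(2) mult_ac)
  moreover have "homogeneous (1 + card R + b) (det3 euler \<theta> y)" by (rule homogeneous_det3[OF homogeneous_field_euler homogeneous\<theta> y(2)])
  moreover have "const k * f \<noteq> 0" using k c by simp
  ultimately have "homogeneous (1 + card R + b - card A) (const k * f)"
    using homogeneous_quotient[OF Q0 homogeneous_arr_poly[OF fin]] by metis
  moreover have "const k * f = const (k * c)" unfolding c(2) by (rule S_eqI) simp
  ultimately have "homogeneous (1 + card R + b - card A) (const (k * c))" by simp
  then have "k * c = 0" by (rule homogeneous_const_pos) (use bm cardR in simp)
  then show False using k c by simp
qed

section \<open>Points of maximal multiplicity and the numerical bounds\<close>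

lemma non_pencil_two_lines:
  assumes arr: "line_arrangement A" and np: "\<not> pencil A"
  obtains H K where "H \<in> A" "K \<in> A" "H \<noteq> K"
proof -
  have "\<exists>H\<in>A. \<not> p \<subseteq> H" if "proj_point p" for p using np that by (auto simp: pencil_def)
  \<comment> \<open>An arbitrary point exhibits a first line; a point on that line then exhibits a
    second.\<close>
  moreover have "proj_point (range (\<lambda>c. c *s (axis 1 1 :: complex^3)))"
    by (rule proj_point_range) (simp add: axis_eq_0_iff)
  ultimately obtain H where H: "H \<in> A" by blast
  then have line: "proj_line H" using arr by (simp add: line_arrangement_def)
  obtain u v where u: "u \<in> H" "cross u v \<noteq> 0" using proj_line_ker3[OF line] by metis
  then have "u \<noteq> 0" by (auto simp: cross_def vec_eq_iff forall_3)
  then have "proj_point (range (\<lambda>c. c *s u))" by (rule proj_point_range)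
  then obtain K where "K \<in> A" "\<not> range (\<lambda>c. c *s u) \<subseteq> K"
    using \<open>\<And>p. proj_point p \<Longrightarrow> \<exists>H\<in>A. \<not> p \<subseteq> H\<close> by blast
  moreover have "range (\<lambda>c. c *s u) \<subseteq> H"
    using range_smult_subset_iff[OF proj_line_subspace[OF line]] u by blast
  ultimately show ?thesis using that H by blast
qed

lemma max_mult_attained:
  assumes arr: "line_arrangement A" and np: "\<not> pencil A"
  obtains p where "p \<in> intersection_points A" "point_mult A p = max_mult A"
proof -
  obtain H K where HK: "H \<in> A" "K \<in> A" "H \<noteq> K" using non_pencil_two_lines[OF assms] .
  have "H \<inter> K \<in> intersection_points A"
    using HK arr proj_point_Int by (intro intersection_pointI[OF _ HK]) (auto simp: line_arrangement_def)
  then have "max_mult A \<in> point_mult A ` intersection_points A"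
    unfolding max_mult_def using finite_intersection_points[OF arr] by (intro Max_in) auto
  then show ?thesis using that by auto
qed

text \<open>The polynomial \<open>b\<close> factors as \<open>(d - m) * (2 * m - d + 1)\<close>.
  Some line misses \<open>p\<close>, so \<open>d - m \<ge> 1\<close> and
  \<open>b \<ge> (2 * m - d) + (d - m) = m \<ge> d / 2\<close>.\<close>

lemma modular_bounds:
  assumes arr: "line_arrangement A" and np: "\<not> pencil A" and mod: "modular_point A p"
    and m: "point_mult A p = m" and d: "card A = d" and "2 * m \<ge> d"
  defines "b \<equiv> - 2 * (real m)\<^sup>2 + (3 * real d - 1) * real m - (real d)\<^sup>2 + real d"
  shows "b \<le> real (card (double_points A))" "real d / 2 \<le> b"
proof -
  have b: "b = (real d - real m) * (2 * real m - real d + 1)"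
    by (simp add: b_def power2_eq_square algebra_simps)
  have "real_of_int ((int d - int m) * (2 * int m - int d + 1)) \<le> real_of_int (int (card (double_points A)))"
    using modular_double_points_bound[OF arr mod] m d by (simp only: of_int_le_iff)
  then show "b \<le> real (card (double_points A))" by (simp add: b)
  have fin: "finite A" using arr by (simp add: line_arrangement_def)
  have "proj_point p" using mod by (auto simp: modular_point_def intersection_points_def)
  then obtain H where "H \<in> A" "\<not> p \<subseteq> H" using np unfolding pencil_def by metis
  then have "{H \<in> A. p \<subseteq> H} \<subset> A" by auto
  then have "m < d" using psubset_card_mono[OF fin] m d by (auto simp: point_mult_def)
  then have "1 \<le> real d - real m" by simp
  moreover have "0 \<le> 2 * real m - real d" using assms(6) by simp
  ultimately have "1 * (2 * real m - real d) \<le> (real d - real m) * (2 * real m - real d)"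
    by (rule mult_right_mono)
  moreover have "b = (real d - real m) * (2 * real m - real d) + (real d - real m)"
    by (simp add: b algebra_simps)
  ultimately show "real d / 2 \<le> b" using \<open>0 \<le> 2 * real m - real d\<close> by argo
qed

theorem theorem1p7:
  fixes A :: "(complex^3) set set" and d n2 :: nat
  assumes "line_arrangement A" and "\<not> pencil A"
    and "d = card A" and "n2 = card (double_points A)"
  shows "(\<forall>m. free_arrangement A \<and> m = max_mult A \<and> 2 * m \<ge> d \<longrightarrow>
            real n2 \<ge> - 2 * (real m)^2 + (3 * real d - 1) * real m - (real d)^2 + real d \<and>
            - 2 * (real m)^2 + (3 * real d - 1) * real m - (real d)^2 + real d \<ge> real d / 2)
       \<and> (\<forall>m. homogeneous_supersolvable m A \<and> 2 * m \<ge> d \<longrightarrow> real n2 \<ge> real d / 2)"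
proof (intro conjI allI impI; elim conjE)
  fix m assume free: "free_arrangement A" and m: "m = max_mult A" and "2 * m \<ge> d"
  obtain p where p: "p \<in> intersection_points A" "point_mult A p = m"
    using max_mult_attained[OF assms(1,2)] m by metis
  have "modular_point A p"
    using free_imp_modular[OF assms(1,2) free p(1)] p \<open>2 * m \<ge> d\<close> assms(3) by simp
  note bounds = modular_bounds[OF assms(1,2) this p(2) assms(3)[symmetric] \<open>2 * m \<ge> d\<close>]
  show "real n2 \<ge> - 2 * (real m)^2 + (3 * real d - 1) * real m - (real d)^2 + real d"
    using bounds(1) assms(4) by simp
  show "- 2 * (real m)^2 + (3 * real d - 1) * real m - (real d)^2 + real d \<ge> real d / 2"
    by (rule bounds(2))
next
  fix m assume "homogeneous_supersolvable m A" and "2 * m \<ge> d"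
  \<comment> \<open>A modular point of multiplicity \<open>m\<close> is given here, so the same
    bounds apply directly.\<close>
  then obtain p where "modular_point A p" "point_mult A p = m"
    by (auto simp: homogeneous_supersolvable_def supersolvable_def)
  from modular_bounds[OF assms(1,2) this assms(3)[symmetric] \<open>2 * m \<ge> d\<close>]
  show "real n2 \<ge> real d / 2" using assms(4) by linarith
qed

end
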